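(* Let $n$ be a positive integer. The poset $\mathcal{PCT}_n$ of partial combinatorial merge trees and the poset $\mathcal{PCB}_n$ of partial combinatorial barcodes are isomorphic to $\tilde{\mathcal{P}}_n$ (the poset of based paths in the partition lattice $\mathcal{P}_n$) and $\tilde{\Pi}_n$ (the poset of based paths in the subset lattice $\Pi_n$), respectively. Furthermore, there is a monotone map $H:\mathcal{P}_n\to\Pi_n$ whose lift $\tilde H:\tilde{\mathcal{P}}_n\to\tilde{\Pi}_n$ is naturally isomorphic to the persistence map $\mathcal{PCT}_n\to\mathcal{PCB}_n$.
   Context: **Paths and lifts.** Let $(P,\preccurlyeq)$ be a poset. A chain is a totally ordered subset of $P$. An interval is a subset $\mathcal I\subseteq P$ such that if $p,q\in\mathcal I$ and $p\preccurlyeq r\preccurlyeq q$, then $r\in\mathcal I$. A path is a chain that is also an interval. A path is based at $x_0\in P$ if its lowest element is $x_0$. If $P$ has a unique lowest element $\hat 0$ (e.g. a lattice), $\tilde P$ denotes the set of paths based at $\hat 0$, which is a poset via containment of paths. There is a unique surjective map $\pi_P:\tilde P\to P$ sending a path to its endpoint (its maximal element). If $f:P\to Q$ is a monotone map of posets, there is a unique map $\tilde f:\tilde P\to\tilde Q$ such that $f\circ\pi_P=\pi_Q\circ\tilde f$; this $\tilde f$ is called the lift of $f$. **Lattices.** Write $[n]=\{1,\ldots,n\}$ and $\mathbf n=\{0,1,\ldots,n\}$. The subset lattice $\Pi_n$ is the set of all subsets of $[n]$, including $\emptyset$, ordered by inclusion, with meet $A\cap B$ and join $A\cup B$; $\tilde\Pi_n$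 is the poset of paths in $\Pi_n$ based at $\emptyset$. A partition of $\mathbf n$ is a collection of disjoint (nonempty) subsets of $\mathbf n$ whose union is $\mathbf n$. A partition $\mathcal U$ refines $\mathcal U'$, written $\mathcal U\preceq\mathcal U'$, if every subset in $\mathcal U'$ is a union of elements of $\mathcal U$. The partition lattice $\mathcal P_n$ is the lattice of partitions of $\mathbf n$ under this order; $\tilde{\mathcal P}_n$ is the poset of paths in $\mathcal P_n$ based at $\{\{0\},\ldots,\{n\}\}$. **Barcodes.** A combinatorial barcode with $n$ bars is a set of pairs $B=\{(i,j)\}$ that is the graph of a permutation of $\{1,\ldots,n\}$; $(i,j)\in B$ means that the $i$th birth endpoint is matched with the $j$th death endpoint. Such a $B$ is filtered into sets $B_1\subset\cdots\subset B_n:=B$, where $B_k$ is the set of pairs $(i,j)\in B$ with $j\le k$. Each $B_k$ is called a partial (combinatorial) barcode. The set of all partial barcodes with at most $n$ bars, ordered by containment, is the poset $\mathcal{PCB}_n$. **Merge trees.** A combinatorial merge tree is a binary, rooted, combinatorial tree with birth-ordered labels $\{0,1,\ldots,n\}$ on the leaves (smaller label meaning older leaf) and death-ordered labels $\{1,\ldots,n\}$ on the internal nodes (merges are ordered by their labels, so an internal node that is a child of another has the smaller label). A partial (combinatorial) merge tree is a filtration of a combinatorial merge tree $T$ with $n+1$ leaves by subgraphs $T_0\subset T_1\subset\cdots\subset T_n:=T$, where $T_k$ is the full subgraph supported on the set of leaf nodes and all internal nodes with label at most $k$; a partial merge tree at stage $k$ is given by $T_0\subset\cdots\subset T_k$.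 Partial merge trees form a poset by subgraph containment, denoted $\mathcal{PCT}_n$. **Persistence map.** The persistence map sends a combinatorial merge tree to its combinatorial barcode by applying persistent homology, i.e. by the Elder Rule: when two branches merge at the internal node labelled $j$, the branch whose oldest (smallest-labelled) leaf is younger dies, and the label $i$ of that leaf is paired with $j$, giving the pair $(i,j)$. It extends to a map from $\mathcal{PCT}_n$ to $\mathcal{PCB}_n$ (at stage $k$, recording the pairs $(i,j)$ with $j\le k$), also called the persistence map. "Naturally isomorphic" means that the two maps correspond under the isomorphisms $\mathcal{PCT}_n\cong\tilde{\mathcal P}_n$ and $\mathcal{PCB}_n\cong\tilde\Pi_n$.
   Formalization: Paths are read as saturated chains (no element can be inserted between two members), since with literal intervals the claim fails for n = 2; lifts are required to be monotone, so that they are unique; the empty partial barcode (stage 0) is included. *)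

theory Defs
  imports
    "HOL-Library.Disjoint_Sets"
    "HOL-Combinatorics.Permutations"
    "HOL-Algebra.Order"
    "Graph_Theory.Graph_Theory"
begin

section \<open>Posets, based paths and lifts\<close>

definition poset_map :: "'a gorder \<Rightarrow> 'b gorder \<Rightarrow> ('a \<Rightarrow> 'b) \<Rightarrow> bool" where
  "poset_map P Q f \<longleftrightarrow> partial_order P \<and> partial_order Q \<and>
     f \<in> carrier P \<rightarrow> carrier Q \<and> isotone P Q f"

definition poset_iso :: "'a gorder \<Rightarrow> 'b gorder \<Rightarrow> ('a \<Rightarrow> 'b) \<Rightarrow> bool" where
  "poset_iso P Q f \<longleftrightarrow> partial_order P \<and> partial_order Q \<and>
     bij_betw f (carrier P) (carrier Q) \<and> order_emb P Q f"

definition chain_in :: "'a gorder \<Rightarrow> 'a set \<Rightarrow> bool" where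
  "chain_in P C \<longleftrightarrow> C \<subseteq> carrier P \<and> (\<forall>x\<in>C. \<forall>y\<in>C. x \<sqsubseteq>\<^bsub>P\<^esub> y \<or> y \<sqsubseteq>\<^bsub>P\<^esub> x)"

text \<open>A path is a chain that is also an interval.  The interval condition has to be read among
  the elements that can be added to the chain, that is, a path is a saturated chain: no further
  element fits in between two elements of the path.  If all \<open>r\<close> with \<open>p \<sqsubseteq> r \<sqsubseteq> q\<close> were required to be
  in \<open>C\<close>, then \<open>{{}, {1}, {1, 2}}\<close> would not be a path in the subset lattice (because of \<open>{2}\<close>), no
  path from \<open>{}\<close> to \<open>{1, 2}\<close> would exist, and the endpoint map would not be surjective.\<close>

definition path_in :: "'a gorder \<Rightarrow> 'a set \<Rightarrow> bool" where
  "path_in P C \<longleftrightarrow> chain_in P C \<and>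
     (\<forall>p\<in>C. \<forall>q\<in>C. \<forall>r\<in>carrier P.
        p \<sqsubseteq>\<^bsub>P\<^esub> r \<and> r \<sqsubseteq>\<^bsub>P\<^esub> q \<and> chain_in P (insert r C) \<longrightarrow> r \<in> C)"

definition path_poset :: "'a gorder \<Rightarrow> 'a set gorder" where
  "path_poset P = \<lparr>carrier = {C. path_in P C \<and> least P \<bottom>\<^bsub>P\<^esub> C}, eq = (=), le = (\<subseteq>)\<rparr>"

definition endpoint :: "'a gorder \<Rightarrow> 'a set \<Rightarrow> 'a" where
  "endpoint P C = (THE m. greatest P m C)"

text \<open>Lifts are morphisms of posets; among arbitrary functions between the sets of paths the
  commutation with the endpoint maps would not determine the lift.\<close>

definition is_lift :: "'a gorder \<Rightarrow> 'b gorder \<Rightarrow> ('a \<Rightarrow> 'b) \<Rightarrow> ('a set \<Rightarrow> 'b set) \<Rightarrow> bool" where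
  "is_lift P Q f g \<longleftrightarrow> poset_map (path_poset P) (path_poset Q) g \<and>
     (\<forall>C\<in>carrier (path_poset P). f (endpoint P C) = endpoint Q (g C))"


section \<open>Subset and partition lattices\<close>

definition subset_lattice :: "nat \<Rightarrow> nat set gorder" where
  "subset_lattice n = \<lparr>carrier = Pow {1..n}, eq = (=), le = (\<subseteq>)\<rparr>"

definition partition_lattice :: "nat \<Rightarrow> nat set set gorder" where
  "partition_lattice n = \<lparr>carrier = {U. partition_on {0..n} U}, eq = (=), le = refines {0..n}\<rparr>"

lemma refines_iff_blocks_are_unions:
  assumes "partition_on A U" "partition_on A V"
  shows "refines A U V \<longleftrightarrow> (\<forall>Y\<in>V. \<exists>F\<subseteq>U. Y = \<Union>F)"
proof
  assume r: "refines A U V"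
  show "\<forall>Y\<in>V. \<exists>F\<subseteq>U. Y = \<Union>F"
  proof
    fix Y assume Y: "Y \<in> V"
    have "Y = \<Union>{X\<in>U. X \<subseteq> Y}"
    proof
      show "Y \<subseteq> \<Union>{X\<in>U. X \<subseteq> Y}"
      proof
        fix y assume y: "y \<in> Y"
        then have "y \<in> A" using Y assms(2) by (auto simp: partition_on_def)
        then obtain X where X: "X \<in> U" "y \<in> X" using assms(1) by (auto simp: partition_on_def)
        then obtain Z where Z: "Z \<in> V" "X \<subseteq> Z" using r by (auto simp: refines_def)
        then have "Z = Y"
          using X y Y assms(2) by (auto simp: partition_on_def disjoint_def)
        then show "y \<in> \<Union>{X\<in>U. X \<subseteq> Y}" using X Z by auto
      qed
    qed auto
    then show "\<exists>F\<subseteq>U. Y = \<Union>F" by (metis (no_types, lifting) mem_Collect_eq subsetI)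
  qed
next
  assume h: "\<forall>Y\<in>V. \<exists>F\<subseteq>U. Y = \<Union>F"
  have "\<exists>Y\<in>V. X \<subseteq> Y" if X: "X \<in> U" for X
  proof -
    obtain x where x: "x \<in> X" using X assms(1) by (metis partition_onD3 equals0I)
    then have "x \<in> A" using X assms(1) by (auto simp: partition_on_def)
    then obtain Y where Y: "Y \<in> V" "x \<in> Y" using assms(2) by (auto simp: partition_on_def)
    then obtain F where F: "F \<subseteq> U" "Y = \<Union>F" using h by blast
    then obtain X' where X': "X' \<in> F" "x \<in> X'" using Y by auto
    then have "X' = X" using x X F assms(1) by (auto simp: partition_on_def disjoint_def)
    then show ?thesis using F X' Y by auto
  qed
  then show "refines A U V" using assms by (auto simp: refines_def)
qed


section \<open>Combinatorial barcodes\<close>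

definition barcode :: "nat \<Rightarrow> (nat \<times> nat) set \<Rightarrow> bool" where
  "barcode n B \<longleftrightarrow> (\<exists>\<sigma>. \<sigma> permutes {1..n} \<and> B = {(i, \<sigma> i) | i. i \<in> {1..n}})"

definition partial_barcode :: "(nat \<times> nat) set \<Rightarrow> nat \<Rightarrow> (nat \<times> nat) set" where
  "partial_barcode B k = {(i, j) \<in> B. j \<le> k}"

text \<open>Stage \<open>k = 0\<close> is the empty barcode; it corresponds to the trivial path and to the stage \<open>T\<^sub>0\<close>
  of a merge tree.\<close>

definition PCB :: "nat \<Rightarrow> (nat \<times> nat) set gorder" where
  "PCB n = \<lparr>carrier = {partial_barcode B k | B k. barcode n B \<and> k \<le> n}, eq = (=), le = (\<subseteq>)\<rparr>"


section \<open>Combinatorial merge trees\<close>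

text \<open>All nodes carry distinct labels, so the label serves as the node itself and labelled trees
  are isomorphic iff they are equal.  Arcs point from a node to its children.\<close>

datatype mnode = Leaf nat | Merge nat

definition rooted_tree :: "('a, 'b) pre_digraph \<Rightarrow> 'a \<Rightarrow> bool" where
  "rooted_tree G r \<longleftrightarrow> wf_digraph G \<and> r \<in> verts G \<and>
     (\<forall>v\<in>verts G. \<exists>!p. pre_digraph.awalk G r p v)"

definition merge_tree :: "nat \<Rightarrow> mnode pair_pre_digraph \<Rightarrow> bool" where
  "merge_tree n T \<longleftrightarrow>
     pverts T = Leaf ` {0..n} \<union> Merge ` {1..n} \<and>
     (\<exists>r. rooted_tree (with_proj T) r) \<and>
     (\<forall>i\<in>{0..n}. out_degree (with_proj T) (Leaf i) = 0) \<and>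
     (\<forall>j\<in>{1..n}. out_degree (with_proj T) (Merge j) = 2) \<and>
     (\<forall>j j'. (Merge j, Merge j') \<in> parcs T \<longrightarrow> j' < j)"

type_synonym mgraph = "(mnode, mnode \<times> mnode) pre_digraph"

definition tree_stage :: "nat \<Rightarrow> mnode pair_pre_digraph \<Rightarrow> nat \<Rightarrow> mgraph" where
  "tree_stage n T k = with_proj T \<restriction> (Leaf ` {0..n} \<union> Merge ` {1..k})"

definition partial_merge_tree :: "nat \<Rightarrow> mnode pair_pre_digraph \<Rightarrow> nat \<Rightarrow> mgraph list" where
  "partial_merge_tree n T k = map (tree_stage n T) [0..<Suc k]"

text \<open>Partial merge trees \<open>[T\<^sub>0, \<dots>, T\<^sub>k]\<close> are compared by containment of their largest subgraphs
  \<open>T\<^sub>k\<close>, which determine the lower stages.\<close>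

definition PCT :: "nat \<Rightarrow> mgraph list gorder" where
  "PCT n = \<lparr>carrier = {partial_merge_tree n T k | T k. merge_tree n T \<and> k \<le> n},
            eq = (=), le = (\<lambda>F F'. subgraph (last F) (last F'))\<rparr>"


section \<open>The persistence map\<close>

definition oldest_leaf :: "mgraph \<Rightarrow> mnode \<Rightarrow> nat" where
  "oldest_leaf G v = Min {i. v \<rightarrow>\<^sup>*\<^bsub>G\<^esub> Leaf i}"

text \<open>The Elder Rule: at the node with label \<open>j\<close> the branch at \<open>d\<close> is younger than the one at \<open>c\<close>,
  hence it dies.\<close>

definition elder_pairs :: "mgraph \<Rightarrow> (nat \<times> nat) set" where
  "elder_pairs G = {(oldest_leaf G d, j) | c d j.
     (Merge j, c) \<in> arcs G \<and> (Merge j, d) \<in> arcs G \<and> oldest_leaf G c < oldest_leaf G d}"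

definition persistence :: "mgraph list \<Rightarrow> (nat \<times> nat) set" where
  "persistence F = elder_pairs (last F)"

text \<open>Applying the Elder Rule to the stage \<open>T\<^sub>k\<close> amounts to recording the pairs of the whole tree up
  to \<open>k\<close>.\<close>

lemma persistence_partial_merge_tree:
  assumes T: "merge_tree n T" and k: "k \<le> n"
  shows "persistence (partial_merge_tree n T k) = partial_barcode (elder_pairs (with_proj T)) k"
proof -
  let ?V = "Leaf ` {0..n} \<union> Merge ` {1..k}" and ?S = "tree_stage n T k"
  have pv: "pverts T = Leaf ` {0..n} \<union> Merge ` {1..n}" using T by (simp add: merge_tree_def)
  interpret pair_wf_digraph T
    using T by (auto simp: merge_tree_def rooted_tree_def wf_digraph_wp_iff)
  have fin: "finite (parcs T)"
    using arc_fst_in_verts arc_snd_in_verts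
    by (intro finite_subset[of "parcs T" "pverts T \<times> pverts T"]) (auto simp: pv, fastforce+)
  have leaf: "(Leaf i, y) \<notin> parcs T" for i y
  proof
    assume a: "(Leaf i, y) \<in> parcs T"
    then have "i \<in> {0..n}" using arc_fst_in_verts[OF a] pv by auto
    then have "out_degree (with_proj T) (Leaf i) = 0" using T by (simp add: merge_tree_def)
    then have "out_arcs (with_proj T) (Leaf i) = {}"
      using fin by (simp add: out_degree_def out_arcs_def)
    then show False using a by (auto simp: out_arcs_def)
  qed
  have desc: "y \<in> ?V" if xy: "(x, y) \<in> parcs T" "x \<in> ?V" for x y
  proof -
    obtain j where j: "x = Merge j" "j \<le> k" using xy leaf by (cases x) auto
    have y: "y \<in> pverts T" using arc_snd_in_verts[OF xy(1)] by simp
    show ?thesis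
    proof (cases y)
      case (Merge j')
      then have "j' < j" using T xy j by (simp add: merge_tree_def)
      then show ?thesis using y Merge j pv by auto
    qed (use y pv in auto)
  qed
  have verts_S: "verts ?S = ?V" by (simp add: tree_stage_def)
  have ends_S: "arcs_ends ?S = {(x, y) \<in> parcs T. x \<in> ?V \<and> y \<in> ?V}"
    unfolding arcs_ends_def arc_to_ends_def tree_stage_def by auto
  have VT: "?V \<subseteq> pverts T" using pv k by auto
  have fwd: "v \<rightarrow>\<^sup>*\<^bsub>?S\<^esub> w" if "v \<rightarrow>\<^sup>*\<^bsub>with_proj T\<^esub> w" "v \<in> ?V" for v w
  proof -
    have "(v, w) \<in> rtrancl_on (verts ?S) (arcs_ends ?S) \<and> w \<in> ?V"
      using that(1)[unfolded reachable_def]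
    proof (induction rule: rtrancl_on_induct)
      case base
      show ?case using that(2) by (simp only: verts_S) auto
    next
      case (step y z)
      then have yz: "(y, z) \<in> parcs T" "y \<in> ?V" by simp_all
      then have z: "z \<in> ?V" by (rule desc)
      with yz have "(y, z) \<in> arcs_ends ?S" unfolding ends_S by blast
      then have "(v, z) \<in> rtrancl_on (verts ?S) (arcs_ends ?S)"
        using step.IH z verts_S by (metis rtrancl_on_into_rtrancl_on)
      with z show ?case by blast
    qed
    then show ?thesis by (simp add: reachable_def)
  qed
  have bwd: "v \<rightarrow>\<^sup>*\<^bsub>with_proj T\<^esub> w" if "v \<rightarrow>\<^sup>*\<^bsub>?S\<^esub> w" for v w
    using that unfolding reachable_def verts_S ends_S
    by (rule rtrancl_on_mono[rotated 2]) (use VT in auto)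
  have old: "oldest_leaf ?S v = oldest_leaf (with_proj T) v" if "v \<in> ?V" for v
    unfolding oldest_leaf_def using fwd[OF _ that] bwd by metis
  have arcs_S: "(Merge j, c) \<in> arcs ?S \<longleftrightarrow> (Merge j, c) \<in> parcs T \<and> j \<le> k" for j c
  proof -
    have "Merge j \<in> ?V" if "(Merge j, c) \<in> parcs T" "j \<le> k"
      using arc_fst_in_verts[OF that(1)] that pv by auto
    then show ?thesis using desc[of "Merge j" c] by (auto simp: tree_stage_def)
  qed
  have in_V: "c \<in> ?V" if "(Merge j, c) \<in> arcs ?S" for j c
    using that by (auto simp: tree_stage_def)
  have "elder_pairs ?S = partial_barcode (elder_pairs (with_proj T)) k"
    unfolding elder_pairs_def partial_barcode_def
    using old in_V arcs_S by (auto 0 4 simp del: Un_iff) (metis+)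
  then show ?thesis by (simp add: persistence_def partial_merge_tree_def)
qed

end

theory Submission
  imports Defs
begin

text \<open>The statement identifies four posets in pairs, and on each side the link is the same kind of
  sequence.

  In a poset with a rank function that grows by exactly one along covers, a based path is a sequence
  \<open>\<bottom> = s 0 \<sqsubset> s 1 \<sqsubset> \<dots> \<sqsubset> s k\<close> in which \<open>s j\<close> has rank \<open>j\<close>, and one path contains another iff it
  extends its sequence (\<open>path_iff_rank_sequence\<close>, \<open>rank_sequence_image_subset_iff\<close>).  The subset
  lattice is graded by cardinality.  The partition lattice is graded by the number of merges that
  lead to a partition, which is \<open>n + 1\<close> minus the number of its blocks; the step from \<open>s j\<close> to
  \<open>s (j + 1)\<close> merges two blocks.

  A partial barcode gives the sequence of sets of birth indices that are paired up to stage \<open>m\<close>.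
  Each stage adds one index, so a sequence of this kind records which birth is paired with which
  death (\<open>poset_iso_births_until\<close>).

  A partial merge tree gives the sequence of partitions of the leaves into the components at
  stage \<open>j\<close>.  The roots of the forest at stage \<open>j\<close> have disjoint leaf sets, hence a block determines
  its root, and the two blocks that are merged next determine the children of the node \<open>j + 1\<close>.
  By induction on the stage the sequence determines the tree, and by the same induction
  each sequence comes from a tree (\<open>poset_iso_levels\<close>).

  The map \<open>H\<close> sends a partition to the set of elements that are not the oldest (smallest) in their
  block, that is, to the classes that have died so far.  It is monotone, and it preserves ranks
  because each block has one oldest element.  Hence the image of a path is a path, the image
  map is a lift, and any lift agrees with it, since its values on the initial segments
  of a path are forced one after the other by the endpoints (\<open>lift_unique\<close>).  When blocks \<open>Y\<close> and \<open>Z\<close>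
  with \<open>Min Y < Min Z\<close> merge, the Elder Rule pairs \<open>Min Z\<close> with this merge, and
  \<open>Min Z\<close> is the one new element of \<open>H\<close> (\<open>nonoldest_merge_blocks\<close>).  So the persistence
  map is the image map of \<open>H\<close> read through the two isomorphisms.\<close>

section \<open>Based paths in graded posets\<close>

lemma partial_order_eqI:
  assumes "\<And>x. x \<in> A \<Longrightarrow> r x x"
    and "\<And>x y. \<lbrakk>x \<in> A; y \<in> A; r x y; r y x\<rbrakk> \<Longrightarrow> x = y"
    and "\<And>x y z. \<lbrakk>x \<in> A; y \<in> A; z \<in> A; r x y; r y z\<rbrakk> \<Longrightarrow> r x z"
  shows "partial_order \<lparr>carrier = A, eq = (=), le = r\<rparr>"
  by unfold_locales (simp_all add: assms(1), (use assms(2,3) in blast)+)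

lemma partial_order_path_poset: "partial_order (path_poset P)"
  unfolding path_poset_def by (rule partial_order_eqI) auto

lemma weak_partial_order_path_poset: "weak_partial_order (path_poset P)"
  by (rule partial_order.axioms(1)[OF partial_order_path_poset])

lemma le_path_poset [simp]: "C \<sqsubseteq>\<^bsub>path_poset P\<^esub> D \<longleftrightarrow> C \<subseteq> D"
  by (simp add: path_poset_def)

text \<open>The enumeration of a based path by rank.  Only the values up to \<open>k\<close> matter; the length \<open>k\<close> is
  kept apart from the sequence so that prefixes need no truncation.\<close>

definition rank_sequence :: "'a gorder \<Rightarrow> ('a \<Rightarrow> nat) \<Rightarrow> (nat \<Rightarrow> 'a) \<Rightarrow> nat \<Rightarrow> bool" where
  "rank_sequence P rank s k \<longleftrightarrow>
     (\<forall>j\<le>k. s j \<in> carrier P \<and> rank (s j) = j) \<and> (\<forall>j<k. s j \<sqsubseteq>\<^bsub>P\<^esub> s (Suc j))"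

lemma rank_sequence_prefix:
  "rank_sequence P rank s k \<Longrightarrow> j \<le> k \<Longrightarrow> rank_sequence P rank s j"
  by (auto simp: rank_sequence_def)

text \<open>The rank of an element tells its position, so an element common to two sequences sits at the same
  place in both.\<close>

lemma rank_sequence_image_subset_iff:
  assumes s: "rank_sequence P rank s k" and t: "rank_sequence P rank t l"
  shows "s ` {..k} \<subseteq> t ` {..l} \<longleftrightarrow> k \<le> l \<and> (\<forall>j\<le>k. s j = t j)"
proof
  assume sub: "s ` {..k} \<subseteq> t ` {..l}"
  have "j \<le> l \<and> s j = t j" if "j \<le> k" for j
  proof -
    have "s j \<in> t ` {..l}" using sub that by (simp add: image_subset_iff)
    then obtain i where i: "i \<le> l" "s j = t i" by auto
    have "rank (s j) = j" using s that unfolding rank_sequence_def by blast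
    moreover have "rank (t i) = i" using t i(1) unfolding rank_sequence_def by blast
    ultimately show ?thesis using i by simp
  qed
  then show "k \<le> l \<and> (\<forall>j\<le>k. s j = t j)" by blast
qed auto

text \<open>Graded posets in the form that is needed here: \<open>interpolate\<close> says that every strict inequality
  starts with a step that raises the rank by one.  The bound \<open>height\<close> makes all chains finite, so that
  paths have endpoints.\<close>

locale graded_poset = partial_order P for P :: "'a gorder" (structure) +
  fixes rank :: "'a \<Rightarrow> nat" and height :: nat
  assumes bottom_exists: "\<exists>b. least P b (carrier P)"
    and rank_bottom: "rank \<bottom> = 0"
    and rank_le_height: "x \<in> carrier P \<Longrightarrow> rank x \<le> height"
    and rank_mono: "\<lbrakk>x \<in> carrier P; y \<in> carrier P; x \<sqsubseteq> y\<rbrakk> \<Longrightarrow> rank x \<le> rank y"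
    and interpolate: "\<lbrakk>x \<in> carrier P; y \<in> carrier P; x \<sqsubseteq> y; x \<noteq> y\<rbrakk> \<Longrightarrow>
       \<exists>z\<in>carrier P. x \<sqsubseteq> z \<and> z \<sqsubseteq> y \<and> rank z = Suc (rank x)"
begin

sublocale weak_partial_order_bottom P
  by unfold_locales (rule bottom_exists)

(* Used as introduction rules, these facts apply to their own premises, and proof search diverges. *)
declare le_cong_l [rule del] le_cong_r [rule del] le_antisym [rule del] weak_refl [rule del, simp del]

lemma rank_less:
  assumes "x \<in> carrier P" "y \<in> carrier P" "x \<sqsubseteq> y" "x \<noteq> y"
  shows "rank x < rank y"
proof -
  obtain z where "z \<in> carrier P" "z \<sqsubseteq> y" "rank z = Suc (rank x)"
    using interpolate[OF assms] by blast
  then show ?thesis using rank_mono[of z y] assms(2) by simp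
qed

lemma eq_if_rank_eq:
  "\<lbrakk>x \<in> carrier P; y \<in> carrier P; x \<sqsubseteq> y; rank x = rank y\<rbrakk> \<Longrightarrow> x = y"
  using rank_less[of x y] by (cases "x = y") simp_all

lemma rank_0_iff: "x \<in> carrier P \<Longrightarrow> rank x = 0 \<longleftrightarrow> x = \<bottom>"
  using eq_if_rank_eq[of \<bottom> x] rank_bottom by auto

lemma rank_sequence_mono:
  assumes s: "rank_sequence P rank s k" and "i \<le> j" "j \<le> k"
  shows "s i \<sqsubseteq> s j"
  using assms(2,3)
proof (induction j rule: dec_induct)
  case base
  then show ?case using s by (auto simp: rank_sequence_def)
next
  case (step j)
  have "s i \<sqsubseteq> s j" "s j \<sqsubseteq> s (Suc j)" "s i \<in> carrier P" "s j \<in> carrier P" "s (Suc j) \<in> carrier P"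
    using step s by (auto simp: rank_sequence_def)
  then show ?case by (blast intro: le_trans)
qed

text \<open>A saturated chain skips no rank.  If rank \<open>i + 1\<close> were missing between consecutive elements, then
  an interpolating element could be added to the chain.  Conversely an element that is comparable with
  all of \<open>s ` {..k}\<close> coincides with the member of its own rank.\<close>

lemma path_iff_rank_sequence:
  "C \<in> carrier (path_poset P) \<longleftrightarrow> (\<exists>s k. rank_sequence P rank s k \<and> C = s ` {..k})"
proof
  assume "C \<in> carrier (path_poset P)"
  then have path: "path_in P C" and bot: "least P \<bottom> C"
    by (auto simp: path_poset_def)
  have "chain_in P C" using path by (simp add: path_in_def)
  then have sub: "C \<subseteq> carrier P" and cmp: "\<And>x y. \<lbrakk>x \<in> C; y \<in> C\<rbrakk> \<Longrightarrow> x \<sqsubseteq> y \<or> y \<sqsubseteq> x"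
    by (simp_all add: chain_in_def)
  have le: "x \<sqsubseteq> y" if "x \<in> C" "y \<in> C" "rank x \<le> rank y" for x y
  proof -
    have "x \<sqsubseteq> y \<or> y \<sqsubseteq> x" using cmp that by blast
    then show ?thesis
    proof
      assume yx: "y \<sqsubseteq> x"
      have c: "x \<in> carrier P" "y \<in> carrier P" using that sub by blast+
      then have "rank y = rank x" using rank_mono[OF c(2,1) yx] that by simp
      then have "y = x" by (rule eq_if_rank_eq[OF c(2,1) yx])
      then show "x \<sqsubseteq> y" using c by simp
    qed
  qed
  have inj: "inj_on rank C"
  proof (rule inj_onI)
    fix x y assume "x \<in> C" "y \<in> C" "rank x = rank y"
    moreover from this have "x \<sqsubseteq> y" by (intro le) simp_all
    ultimately show "x = y" using sub by (intro eq_if_rank_eq) blast+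
  qed
  define k where "k = Max (rank ` C)"
  have fin: "finite (rank ` C)"
    using rank_le_height sub by (intro finite_subset[of "rank ` C" "{..height}"]) auto
  have ne: "\<bottom> \<in> C" using bot by (rule least_mem)
  then obtain top where top: "top \<in> C" "rank top = k"
    using Max_in[OF fin] unfolding k_def by (metis (no_types, lifting) empty_iff image_iff)
  have "j \<in> rank ` C" if "j \<le> k" for j
    using that
  proof (induction j)
    case 0
    then show ?case using ne rank_bottom by (metis image_eqI)
  next
    case (Suc i)
    then obtain x where x: "x \<in> C" "rank x = i" by auto
    \<comment> \<open>The element of \<open>C\<close> that comes next after \<open>x\<close>.\<close>
    define y where "y = arg_min rank (\<lambda>y. y \<in> C \<and> i < rank y)"
    have y: "y \<in> C" "i < rank y"
      using arg_min_natI[of "\<lambda>y. y \<in> C \<and> i < rank y" top rank] top Suc.prems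
      by (auto simp: y_def)
    have y_min: "rank y \<le> rank w" if "w \<in> C" "i < rank w" for w
      using arg_min_nat_le[of "\<lambda>y. y \<in> C \<and> i < rank y" w rank] that by (simp add: y_def)
    have xc: "x \<in> carrier P" and yc: "y \<in> carrier P" using x y sub by auto
    obtain z where z: "z \<in> carrier P" "x \<sqsubseteq> z" "z \<sqsubseteq> y" "rank z = Suc i"
      using interpolate[OF xc yc le] x y by fastforce
    \<comment> \<open>No element of \<open>C\<close> has its rank strictly between those of \<open>x\<close> and \<open>y\<close>, so \<open>z\<close> is comparable
      with all of \<open>C\<close>, and saturation puts it into \<open>C\<close>.\<close>
    have "w \<sqsubseteq> z \<or> z \<sqsubseteq> w" if w: "w \<in> C" for w
    proof (cases "rank w \<le> i")
      case True
      then have "w \<sqsubseteq> x" using le w x by simp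
      then show ?thesis using z w sub xc by (blast intro: le_trans)
    next
      case False
      then have "y \<sqsubseteq> w" using le w y y_min by simp
      then show ?thesis using z w sub yc by (blast intro: le_trans)
    qed
    then have "chain_in P (insert z C)"
      using cmp sub z(1) by (auto simp: chain_in_def)
    then have "z \<in> C" using path x(1) y(1) z(1-3) unfolding path_in_def by blast
    then show ?case using z by force
  qed
  then have ranks: "rank ` C = {..k}" using fin by (auto simp: k_def)
  let ?s = "inv_into C rank"
  have s: "?s j \<in> C" "rank (?s j) = j" if "j \<le> k" for j
    using that ranks by (auto intro: inv_into_into f_inv_into_f)
  have "rank_sequence P rank ?s k"
    unfolding rank_sequence_def using s sub le by (auto simp: subset_iff)
  moreover have "C = ?s ` {..k}"
    using ranks inj by (metis inv_into_image_cancel order_refl)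
  ultimately show "\<exists>s k. rank_sequence P rank s k \<and> C = s ` {..k}" by blast
next
  assume "\<exists>s k. rank_sequence P rank s k \<and> C = s ` {..k}"
  then obtain s k where s: "rank_sequence P rank s k" and C: "C = s ` {..k}" by blast
  have sc: "s j \<in> carrier P" "rank (s j) = j" if "j \<le> k" for j
    using s that by (auto simp: rank_sequence_def)
  have chain: "chain_in P C"
    unfolding chain_in_def C
    using sc(1) rank_sequence_mono[OF s] by (auto; metis nat_le_linear)
  have "r \<in> C" if q: "q \<in> C" and r: "r \<in> carrier P" "r \<sqsubseteq> q" and ch: "chain_in P (insert r C)"
    for q r
  proof -
    have k: "rank r \<le> k" using rank_mono[of r q] q r sc C by fastforce
    then have "r \<sqsubseteq> s (rank r) \<or> s (rank r) \<sqsubseteq> r" using ch C by (auto simp: chain_in_def)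
    then have "r = s (rank r)" using eq_if_rank_eq[of r "s (rank r)"] eq_if_rank_eq[of "s (rank r)" r]
        sc[OF k] r by auto
    then show ?thesis using k C by auto
  qed
  then have "path_in P C" using chain by (auto simp: path_in_def)
  moreover have "s 0 = \<bottom>" using rank_0_iff sc[of 0] by simp
  then have "least P \<bottom> C"
    using sc(1) C by (auto simp: least_def image_iff intro!: bexI[of _ 0])
  ultimately show "C \<in> carrier (path_poset P)" by (simp add: path_poset_def)
qed

lemma endpoint_rank_sequence:
  assumes s: "rank_sequence P rank s k"
  shows "endpoint P (s ` {..k}) = s k"
proof -
  have "greatest P (s k) (s ` {..k})"
    using s rank_sequence_mono[OF s] by (auto simp: greatest_def rank_sequence_def)
  then show ?thesis
    unfolding endpoint_def by (blast intro: greatest_unique)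
qed

text \<open>The common frame of the two isomorphisms: a poset whose elements are faithfully and completely
  described by rank sequences, ordered by prefix, is isomorphic to the path poset.\<close>

lemma poset_iso_path_posetI:
  assumes X: "partial_order X"
    and seq: "\<And>x. x \<in> carrier X \<Longrightarrow> rank_sequence P rank (s x) (k x)"
    and emb: "\<And>x y. \<lbrakk>x \<in> carrier X; y \<in> carrier X\<rbrakk> \<Longrightarrow>
       x \<sqsubseteq>\<^bsub>X\<^esub> y \<longleftrightarrow> k x \<le> k y \<and> (\<forall>j\<le>k x. s x j = s y j)"
    and surj: "\<And>t l. rank_sequence P rank t l \<Longrightarrow>
       \<exists>x\<in>carrier X. k x = l \<and> (\<forall>j\<le>l. s x j = t j)"
  shows "poset_iso X (path_poset P) (\<lambda>x. s x ` {..k x})"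
proof -
  interpret X: partial_order X by (rule X)
  have le: "s x ` {..k x} \<subseteq> s y ` {..k y} \<longleftrightarrow> x \<sqsubseteq>\<^bsub>X\<^esub> y" if "x \<in> carrier X" "y \<in> carrier X" for x y
    using emb rank_sequence_image_subset_iff[OF seq seq] that by simp
  have "inj_on (\<lambda>x. s x ` {..k x}) (carrier X)"
  proof (rule inj_onI)
    fix x y assume xy: "x \<in> carrier X" "y \<in> carrier X" "s x ` {..k x} = s y ` {..k y}"
    have "x \<sqsubseteq>\<^bsub>X\<^esub> y" "y \<sqsubseteq>\<^bsub>X\<^esub> x" using le[of x y] le[of y x] xy by simp_all
    then show "x = y" using X.le_antisym xy(1,2) by blast
  qed
  moreover have "(\<lambda>x. s x ` {..k x}) ` carrier X = carrier (path_poset P)"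
  proof
    show "(\<lambda>x. s x ` {..k x}) ` carrier X \<subseteq> carrier (path_poset P)"
      using seq path_iff_rank_sequence by blast
    show "carrier (path_poset P) \<subseteq> (\<lambda>x. s x ` {..k x}) ` carrier X"
    proof
      fix C assume "C \<in> carrier (path_poset P)"
      then obtain t l where t: "rank_sequence P rank t l" "C = t ` {..l}"
        using path_iff_rank_sequence by blast
      then obtain x where "x \<in> carrier X" "k x = l" "\<forall>j\<le>l. s x j = t j" using surj by blast
      then show "C \<in> (\<lambda>x. s x ` {..k x}) ` carrier X"
        using t by (intro image_eqI[of _ _ x]) (auto intro: image_cong)
    qed
  qed
  moreover have "order_emb X (path_poset P) (\<lambda>x. s x ` {..k x})"
    using le X.weak_partial_order_axioms weak_partial_order_path_poset
    by (simp add: order_emb_def)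
  ultimately show ?thesis
    using X partial_order_path_poset by (simp add: poset_iso_def bij_betw_def)
qed

end

locale rank_preserving_map =
  dom: graded_poset P rank height + cod: graded_poset Q rank' height'
  for P :: "'a gorder" and rank height and Q :: "'b gorder" and rank' height' +
  fixes f :: "'a \<Rightarrow> 'b"
  assumes poset_map: "poset_map P Q f"
    and rank_eq: "x \<in> carrier P \<Longrightarrow> rank' (f x) = rank x"
begin

lemma rank_sequence_image:
  "rank_sequence P rank s k \<Longrightarrow> rank_sequence Q rank' (f \<circ> s) k"
  using poset_map rank_eq
  by (auto simp: rank_sequence_def poset_map_def isotone_def)

lemma image_is_lift: "is_lift P Q f ((`) f)"
proof -
  have "f ` C \<in> carrier (path_poset Q)" "f (endpoint P C) = endpoint Q (f ` C)"
    if "C \<in> carrier (path_poset P)" for C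
  proof -
    obtain s k where s: "rank_sequence P rank s k" "C = s ` {..k}"
      using \<open>C \<in> _\<close> dom.path_iff_rank_sequence by blast
    then have t: "rank_sequence Q rank' (f \<circ> s) k" "f ` C = (f \<circ> s) ` {..k}"
      by (auto simp: rank_sequence_image image_comp)
    show "f ` C \<in> carrier (path_poset Q)" using t cod.path_iff_rank_sequence by blast
    show "f (endpoint P C) = endpoint Q (f ` C)"
      using dom.endpoint_rank_sequence[OF s(1)] cod.endpoint_rank_sequence[OF t(1)] s(2) t(2)
      by simp
  qed
  then show ?thesis
    using partial_order_path_poset[of P] partial_order_path_poset[of Q]
      weak_partial_order_path_poset[of P] weak_partial_order_path_poset[of Q]
    by (simp add: is_lift_def poset_map_def isotone_def image_mono)
qed

text \<open>The endpoint condition, applied to all initial segments of a path, forces every element of the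
  image.  Monotonicity glues the segments together.\<close>

lemma lift_unique:
  assumes g: "is_lift P Q f g" and C: "C \<in> carrier (path_poset P)"
  shows "g C = f ` C"
proof -
  obtain s k where s: "rank_sequence P rank s k" "C = s ` {..k}"
    using C dom.path_iff_rank_sequence by blast
  have prefix: "s ` {..j} \<in> carrier (path_poset P)" if "j \<le> k" for j
    using rank_sequence_prefix[OF s(1) that] dom.path_iff_rank_sequence by blast
  \<comment> \<open>\<open>g\<close> sends the initial segment of length \<open>j\<close> to a path ending in \<open>f (s j)\<close>, hence of length \<open>j\<close>.\<close>
  have seg: "\<exists>t. rank_sequence Q rank' t j \<and> g (s ` {..j}) = t ` {..j} \<and> t j = f (s j)"
    if j: "j \<le> k" for j
  proof -
    have "g (s ` {..j}) \<in> carrier (path_poset Q)"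
      using g prefix[OF j] unfolding is_lift_def poset_map_def by blast
    then obtain t l where t: "rank_sequence Q rank' t l" "g (s ` {..j}) = t ` {..l}"
      using cod.path_iff_rank_sequence by blast
    have "f (s j) = t l"
    proof -
      have "f (endpoint P (s ` {..j})) = endpoint Q (g (s ` {..j}))"
        using g prefix[OF j] unfolding is_lift_def by blast
      then show ?thesis
        using dom.endpoint_rank_sequence[OF rank_sequence_prefix[OF s(1) j]]
          cod.endpoint_rank_sequence[OF t(1)] t(2) by simp
    qed
    moreover have "rank' (f (s j)) = j" using s(1) j rank_eq by (auto simp: rank_sequence_def)
    ultimately have "l = j" using t(1) by (auto simp: rank_sequence_def)
    then show ?thesis using t \<open>f (s j) = t l\<close> by auto
  qed
  obtain t where t: "rank_sequence Q rank' t k" "g C = t ` {..k}" using seg[of k] s by auto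
  have "t j = f (s j)" if j: "j \<le> k" for j
  proof -
    obtain u where u: "rank_sequence Q rank' u j" "g (s ` {..j}) = u ` {..j}" "u j = f (s j)"
      using seg[OF j] by blast
    have "s ` {..j} \<subseteq> C" using j s(2) by auto
    then have "g (s ` {..j}) \<subseteq> g C"
      using g prefix[OF j] C unfolding is_lift_def poset_map_def isotone_def by simp
    then show ?thesis
      using rank_sequence_image_subset_iff[OF u(1) t(1)] u t by auto
  qed
  then show ?thesis using t(2) s(2) by (auto simp: image_iff)
qed

end

section \<open>The subset lattice and the partition lattice\<close>

lemma bottom_eqI: "partial_order P \<Longrightarrow> least P b (carrier P) \<Longrightarrow> \<bottom>\<^bsub>P\<^esub> = b"
  unfolding bottom_def by (metis partial_order.least_unique someI)

lemma graded_poset_subset_lattice: "graded_poset (subset_lattice n) card n"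
proof -
  have po: "partial_order (subset_lattice n)"
    unfolding subset_lattice_def by (rule partial_order_eqI) auto
  have least: "least (subset_lattice n) {} (carrier (subset_lattice n))"
    by (auto simp: least_def subset_lattice_def)
  have fin: "finite x" if "x \<subseteq> {1..n}" for x using that finite_subset by blast
  have "\<exists>z\<in>Pow {1..n}. x \<subseteq> z \<and> z \<subseteq> y \<and> card z = Suc (card x)"
    if xy: "x \<subseteq> {1..n}" "y \<subseteq> {1..n}" "x \<subseteq> y" "x \<noteq> y" for x y
  proof -
    obtain a where "a \<in> y" "a \<notin> x" using xy by blast
    then show ?thesis using xy fin[of x] by (intro bexI[of _ "insert a x"]) auto
  qed
  moreover have "card x \<le> n" if "x \<subseteq> {1..n}" for x
    using card_mono[OF _ that] by simp
  ultimately show ?thesis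
    using po least bottom_eqI[OF po least] fin
    by (intro graded_poset.intro graded_poset_axioms.intro)
      (auto simp: subset_lattice_def card_mono)
qed

definition merge_blocks :: "'a set set \<Rightarrow> 'a set \<Rightarrow> 'a set \<Rightarrow> 'a set set" where
  "merge_blocks U Y Z = insert (Y \<union> Z) (U - {Y, Z})"

lemma partition_on_block_eq:
  "\<lbrakk>partition_on A U; Y \<in> U; Z \<in> U; x \<in> Y; x \<in> Z\<rbrakk> \<Longrightarrow> Y = Z"
  by (auto simp: partition_on_def disjoint_def)

lemma union_of_blocks_notin_partition:
  assumes U: "partition_on A U" and YZ: "Y \<in> U" "Z \<in> U" "Y \<noteq> Z"
  shows "Y \<union> Z \<notin> U"
proof
  assume "Y \<union> Z \<in> U"
  moreover obtain y z where "y \<in> Y" "z \<in> Z" using U YZ by (metis partition_onD3 ex_in_conv)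
  ultimately have "Y = Y \<union> Z" "Z = Y \<union> Z" using partition_on_block_eq[OF U] YZ by blast+
  then show False using YZ by simp
qed

lemma refines_merge_blocks:
  assumes U: "partition_on A U" and YZ: "Y \<in> U" "Z \<in> U" "Y \<noteq> Z"
  shows "refines A U (merge_blocks U Y Z)"
proof -
  have "partition_on A (merge_blocks U Y Z)"
  proof (rule partition_onI)
    show "\<Union> (merge_blocks U Y Z) = A"
      using partition_onD1[OF U] YZ by (auto simp: merge_blocks_def)
    show "disjnt p q" if "p \<in> merge_blocks U Y Z" "q \<in> merge_blocks U Y Z" "p \<noteq> q" for p q
    proof -
      have "disjnt p' q'" if "p' \<in> U" "q' \<in> U" "p' \<noteq> q'" for p' q'
        using partition_onD2[OF U] that by (simp add: pairwise_def)
      then show ?thesis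
        using that YZ unfolding merge_blocks_def
        by (elim insertE) (simp_all add: disjnt_Un1 disjnt_Un2, blast+)
    qed
    show "{} \<notin> merge_blocks U Y Z"
      using partition_onD3[OF U] YZ by (auto simp: merge_blocks_def)
  qed
  moreover have "\<exists>W\<in>merge_blocks U Y Z. X \<subseteq> W" if "X \<in> U" for X
  proof (cases "X = Y \<or> X = Z")
    case True
    then show ?thesis by (intro bexI[of _ "Y \<union> Z"]) (auto simp: merge_blocks_def)
  next
    case False
    then show ?thesis using that by (intro bexI[of _ X]) (auto simp: merge_blocks_def)
  qed
  ultimately show ?thesis using U by (simp add: refines_def)
qed

lemma card_merge_blocks:
  assumes U: "partition_on A U" and fin: "finite U" and YZ: "Y \<in> U" "Z \<in> U" "Y \<noteq> Z"
  shows "Suc (card (merge_blocks U Y Z)) = card U"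
proof -
  have "card (merge_blocks U Y Z) = Suc (card (U - {Y, Z}))"
    using union_of_blocks_notin_partition[OF assms(1,3-5)] fin by (simp add: merge_blocks_def)
  moreover have "card (U - {Y, Z}) = card U - 2"
    using YZ by (subst card_Diff_subset) auto
  moreover have "card {Y, Z} \<le> card U"
    using YZ fin by (intro card_mono) auto
  then have "2 \<le> card U" using YZ by simp
  ultimately show ?thesis by simp
qed

text \<open>If no block of \<open>V\<close> contained two blocks of \<open>U\<close>, then the blocks of \<open>V\<close>, being unions of blocks of
  \<open>U\<close>, would be blocks of \<open>U\<close>, and \<open>U\<close> and \<open>V\<close> would refine each other.  This is the interpolation
  property of the partition lattice.\<close>

lemma ex_merge_blocks_refines:
  assumes r: "refines A U V" and ne: "U \<noteq> V"
  shows "\<exists>Y\<in>U. \<exists>Z\<in>U. Y \<noteq> Z \<and> refines A (merge_blocks U Y Z) V"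
proof -
  have U: "partition_on A U" and V: "partition_on A V" using r by (auto simp: refines_def)
  have "\<exists>X\<in>V. \<exists>Y\<in>U. \<exists>Z\<in>U. Y \<noteq> Z \<and> Y \<subseteq> X \<and> Z \<subseteq> X"
  proof (rule ccontr)
    assume separate: "\<not> ?thesis"
    have "X \<in> U" if X: "X \<in> V" for X
    proof -
      obtain F where F: "F \<subseteq> U" "X = \<Union>F"
        using r X refines_iff_blocks_are_unions[OF U V] by blast
      have "X \<noteq> {}" using V X by (metis partition_onD3)
      then obtain Y where Y: "Y \<in> F" using F by auto
      have "Z = Y" if Z: "Z \<in> F" for Z
      proof -
        have "Y \<in> U" "Z \<in> U" "Y \<subseteq> X" "Z \<subseteq> X" using F Y Z by auto
        then show ?thesis using separate X by blast
      qed
      then have "F = {Y}" using Y by blast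
      then show ?thesis using F by simp
    qed
    then have "refines A V U" using U V by (auto simp: refines_def)
    then show False using r ne refines_asym by blast
  qed
  then obtain X Y Z where YZ: "Y \<in> U" "Z \<in> U" "Y \<noteq> Z" and X: "X \<in> V" "Y \<subseteq> X" "Z \<subseteq> X" by blast
  have "partition_on A (merge_blocks U Y Z)"
    using refines_merge_blocks[OF U YZ] by (simp add: refines_def)
  moreover have "\<exists>X\<in>V. W \<subseteq> X" if "W \<in> merge_blocks U Y Z" for W
    using that r X by (auto simp: merge_blocks_def refines_def)
  ultimately have "refines A (merge_blocks U Y Z) V" using V by (simp add: refines_def)
  then show ?thesis using YZ by blast
qed

text \<open>Sending a block of \<open>U\<close> to the block of \<open>V\<close> around it is a surjection.\<close>

lemma card_le_if_refines:
  assumes r: "refines A U V" and fin: "finite U"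
  shows "card V \<le> card U"
proof -
  have U: "partition_on A U" and V: "partition_on A V" using r by (auto simp: refines_def)
  obtain g where g: "\<And>Y. Y \<in> U \<Longrightarrow> g Y \<in> V \<and> Y \<subseteq> g Y" using r unfolding refines_def by metis
  have "X \<in> g ` U" if X: "X \<in> V" for X
  proof -
    obtain x where x: "x \<in> X" using V X by (metis partition_onD3 ex_in_conv)
    then obtain Y where Y: "Y \<in> U" "x \<in> Y"
      using X partition_onD1[OF U] partition_onD1[OF V] by blast
    then have "g Y = X" using g[OF Y(1)] partition_on_block_eq[OF V _ X, of "g Y" x] x by blast
    then show ?thesis using Y by blast
  qed
  then show ?thesis using fin by (meson surj_card_le subsetI)
qed

abbreviation partition_rank :: "nat \<Rightarrow> nat set set \<Rightarrow> nat" where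
  "partition_rank n U \<equiv> Suc n - card U"

lemma finite_partition_0n: "partition_on {0..n::nat} U \<Longrightarrow> finite U"
  by (rule finite_elements[of "{0..n}"]) simp_all

lemma refines_singletons:
  assumes U: "partition_on A U"
  shows "refines A ((\<lambda>x. {x}) ` A) U"
proof -
  have "\<exists>X\<in>U. {x} \<subseteq> X" if "x \<in> A" for x using partition_onD1[OF U] that by simp
  then show ?thesis using U partition_on_singletons[of A] by (simp add: refines_def)
qed

lemma card_partition_le:
  assumes U: "partition_on {0..n::nat} U"
  shows "card U \<le> Suc n"
proof -
  have "card U \<le> card ((\<lambda>x. {x}) ` {0..n})"
    by (rule card_le_if_refines[OF refines_singletons[OF U]]) simp
  then show ?thesis by (simp add: card_image)
qed

lemma card_partition_pos:
  assumes U: "partition_on {0..n::nat} U"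
  shows "1 \<le> card U"
proof -
  have "U \<noteq> {}" using partition_onD1[OF U] by auto
  then show ?thesis using finite_partition_0n[OF U] by (simp add: Suc_le_eq card_gt_0_iff)
qed

lemma partition_rank_merge_blocks:
  assumes U: "partition_on {0..n} U" and YZ: "Y \<in> U" "Z \<in> U" "Y \<noteq> Z"
  shows "partition_rank n (merge_blocks U Y Z) = Suc (partition_rank n U)"
  using card_merge_blocks[OF U finite_partition_0n[OF U] YZ] card_partition_le[OF U] by linarith

lemma least_partition_lattice:
  "least (partition_lattice n) ((\<lambda>x. {x}) ` {0..n}) (carrier (partition_lattice n))"
  by (simp add: least_def partition_lattice_def refines_singletons partition_on_singletons)

lemma partial_order_partition_lattice: "partial_order (partition_lattice n)"
  unfolding partition_lattice_def
  by (rule partial_order_eqI) (auto intro: refines_refl refines_trans dest: refines_asym)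

lemmas bottom_partition_lattice =
  bottom_eqI[OF partial_order_partition_lattice least_partition_lattice]

lemma graded_poset_partition_lattice:
  "graded_poset (partition_lattice n) (partition_rank n) n"
proof (intro graded_poset.intro graded_poset_axioms.intro)
  show "partial_order (partition_lattice n)" by (rule partial_order_partition_lattice)
  show "\<exists>b. least (partition_lattice n) b (carrier (partition_lattice n))"
    using least_partition_lattice by blast
  show "partition_rank n \<bottom>\<^bsub>partition_lattice n\<^esub> = 0"
    by (simp add: bottom_partition_lattice card_image)
next
  fix x assume "x \<in> carrier (partition_lattice n)"
  then show "partition_rank n x \<le> n"
    using card_partition_pos[of n x] by (simp add: partition_lattice_def)
next
  fix x y assume "x \<in> carrier (partition_lattice n)" "x \<sqsubseteq>\<^bsub>partition_lattice n\<^esub> y"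
  then show "partition_rank n x \<le> partition_rank n y"
    using card_le_if_refines[of "{0..n}" x y] finite_partition_0n[of n x]
    by (simp add: partition_lattice_def diff_le_mono2)
next
  fix x y
  assume x: "x \<in> carrier (partition_lattice n)" and "x \<sqsubseteq>\<^bsub>partition_lattice n\<^esub> y" "x \<noteq> y"
  then obtain Y Z where YZ: "Y \<in> x" "Z \<in> x" "Y \<noteq> Z" "refines {0..n} (merge_blocks x Y Z) y"
    using ex_merge_blocks_refines[of "{0..n}" x y] by (auto simp: partition_lattice_def)
  have "partition_on {0..n} x" using x by (simp add: partition_lattice_def)
  then show "\<exists>z\<in>carrier (partition_lattice n). x \<sqsubseteq>\<^bsub>partition_lattice n\<^esub> z \<and>
      z \<sqsubseteq>\<^bsub>partition_lattice n\<^esub> y \<and> partition_rank n z = Suc (partition_rank n x)"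
    using YZ refines_merge_blocks[of "{0..n}" x Y Z] partition_rank_merge_blocks[of n x Y Z]
    by (intro bexI[of _ "merge_blocks x Y Z"]) (auto simp: partition_lattice_def refines_def)
qed

text \<open>A merge of two blocks of \<open>s j\<close> that still refines \<open>s (j + 1)\<close> has the same rank as \<open>s (j + 1)\<close>,
  hence equals it.\<close>

lemma partition_rank_sequence_Suc:
  assumes s: "rank_sequence (partition_lattice n) (partition_rank n) s k" and j: "j < k"
  shows "\<exists>Y\<in>s j. \<exists>Z\<in>s j. Y \<noteq> Z \<and> s (Suc j) = merge_blocks (s j) Y Z"
proof -
  interpret graded_poset "partition_lattice n" "partition_rank n" n
    by (rule graded_poset_partition_lattice)
  have part: "partition_on {0..n} (s i)" "partition_rank n (s i) = i" if "i \<le> k" for i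
    using s that by (auto simp: rank_sequence_def partition_lattice_def)
  have r: "refines {0..n} (s j) (s (Suc j))"
    using s j by (auto simp: rank_sequence_def partition_lattice_def)
  have "s j \<noteq> s (Suc j)" using part(2)[of j] part(2)[of "Suc j"] j by auto
  from ex_merge_blocks_refines[OF r this]
  obtain Y Z where YZ: "Y \<in> s j" "Z \<in> s j" "Y \<noteq> Z"
    and r': "refines {0..n} (merge_blocks (s j) Y Z) (s (Suc j))" by blast
  have "partition_rank n (merge_blocks (s j) Y Z) = partition_rank n (s (Suc j))"
    using partition_rank_merge_blocks[OF part(1) YZ] part(2)[of j] part(2)[of "Suc j"] j by simp
  then have "merge_blocks (s j) Y Z = s (Suc j)"
    using r' by (intro eq_if_rank_eq) (auto simp: partition_lattice_def refines_def)
  then show ?thesis using YZ by metis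
qed

section \<open>The map from partitions to subsets\<close>

text \<open>The map \<open>H\<close> of the theorem: each block of \<open>U\<close> is a connected component, whose homology class is
  named by its oldest element.  The other elements name classes that have died.\<close>

definition nonoldest :: "nat \<Rightarrow> nat set set \<Rightarrow> nat set" where
  "nonoldest n U = {0..n} - Min ` U"

lemma block_Min_in:
  assumes U: "partition_on {0..n::nat} U" and X: "X \<in> U"
  shows "finite X" "X \<noteq> {}" "Min X \<in> X" "Min X \<in> {0..n}"
proof -
  have "X \<subseteq> {0..n}" using partition_onD1[OF U] X by auto
  then show f: "finite X" using finite_subset by blast
  show "X \<noteq> {}" using U X by (metis partition_onD3)
  then show m: "Min X \<in> X" using f by simp
  show "Min X \<in> {0..n}" using m \<open>X \<subseteq> {0..n}\<close> by blast
qed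

lemma inj_on_Min_partition:
  assumes U: "partition_on {0..n::nat} U"
  shows "inj_on Min U"
  by (rule inj_onI) (metis U block_Min_in(3) partition_on_block_eq)

text \<open>The oldest element of a coarse block is also the oldest in its fine block.\<close>

lemma Min_image_antimono:
  assumes r: "refines {0..n::nat} U V"
  shows "Min ` V \<subseteq> Min ` U"
proof
  fix m assume "m \<in> Min ` V"
  then obtain X where X: "X \<in> V" "m = Min X" by blast
  have U: "partition_on {0..n} U" and V: "partition_on {0..n} V" using r by (auto simp: refines_def)
  have m: "m \<in> X" "m \<in> {0..n}" using block_Min_in[OF V X(1)] X(2) by auto
  then obtain Y where Y: "Y \<in> U" "m \<in> Y" using partition_onD1[OF U] by blast
  obtain X' where X': "X' \<in> V" "Y \<subseteq> X'" using r Y(1) by (auto simp: refines_def)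
  then have "X' = X" using partition_on_block_eq[OF V X'(1) X(1), of m] Y m by blast
  then have "Min Y = m"
    using X X' Y block_Min_in[OF V X(1)] block_Min_in[OF U Y(1)]
    by (intro Min_eqI) auto
  then show "m \<in> Min ` U" using Y by blast
qed

lemma nonoldest_subset:
  assumes U: "partition_on {0..n} U"
  shows "nonoldest n U \<subseteq> {1..n}"
proof -
  have "0 \<in> \<Union>U" using partition_onD1[OF U, symmetric] by simp
  then obtain X where X: "X \<in> U" "0 \<in> X" by blast
  then have "Min X = 0" using block_Min_in(1)[OF U X(1)] by (intro Min_eqI) auto
  then have "0 \<in> Min ` U" using X by (metis image_eqI)
  then show ?thesis unfolding nonoldest_def by (auto simp: Suc_le_eq intro: gr0I)
qed

lemma card_nonoldest:
  assumes U: "partition_on {0..n} U"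
  shows "card (nonoldest n U) = partition_rank n U"
proof -
  have "card (nonoldest n U) = card {0..n} - card (Min ` U)"
    unfolding nonoldest_def
    using block_Min_in(4)[OF U] finite_partition_0n[OF U] by (intro card_Diff_subset) auto
  then show ?thesis using card_image[OF inj_on_Min_partition[OF U]] by simp
qed

text \<open>The Elder Rule at the level of partitions: of the two oldest elements only the older one stays
  the oldest in its block.\<close>

lemma nonoldest_merge_blocks:
  assumes U: "partition_on {0..n} U" and YZ: "Y \<in> U" "Z \<in> U" and lt: "Min Y < Min Z"
  shows "nonoldest n (merge_blocks U Y Z) = insert (Min Z) (nonoldest n U)"
proof -
  have "Min (Y \<union> Z) = Min Y"
    using block_Min_in[OF U YZ(1)] block_Min_in[OF U YZ(2)] lt by (simp add: Min_Un)
  then have "Min ` merge_blocks U Y Z = insert (Min Y) (Min ` (U - {Y, Z}))"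
    by (simp add: merge_blocks_def)
  also have "\<dots> = insert (Min Y) (Min ` U - {Min Y, Min Z})"
    using inj_on_image_set_diff[OF inj_on_Min_partition[OF U], of U "{Y, Z}"] YZ by simp
  also have "\<dots> = Min ` U - {Min Z}" using YZ lt by auto
  finally show ?thesis
    using block_Min_in(4)[OF U YZ(2)] by (auto simp: nonoldest_def)
qed

lemma poset_map_nonoldest:
  "poset_map (partition_lattice n) (subset_lattice n) (nonoldest n)"
proof -
  have "partial_order (subset_lattice n)"
    by (rule graded_poset.axioms(1)[OF graded_poset_subset_lattice])
  moreover have "nonoldest n U \<subseteq> nonoldest n V" if "refines {0..n} U V" for U V
    using Min_image_antimono[OF that] by (auto simp: nonoldest_def)
  ultimately show ?thesis
    using partial_order_partition_lattice[of n] nonoldest_subset[of n]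
    by (auto simp: poset_map_def isotone_def partial_order.axioms(1))
      (auto simp: partition_lattice_def subset_lattice_def)
qed

lemma rank_preserving_map_nonoldest:
  "rank_preserving_map (partition_lattice n) (partition_rank n) n (subset_lattice n) card n
     (nonoldest n)"
  by (intro rank_preserving_map.intro rank_preserving_map_axioms.intro
      graded_poset_partition_lattice graded_poset_subset_lattice poset_map_nonoldest)
    (simp add: partition_lattice_def card_nonoldest)

section \<open>Partial barcodes are based paths of subsets\<close>

text \<open>A partial barcode up to stage \<open>k\<close>, given by the birth index \<open>b j\<close> that is paired with the death
  \<open>j\<close>; this is the inverse of the permutation in the definition of a barcode, cut off at \<open>k\<close>.\<close>

definition bars :: "(nat \<Rightarrow> nat) \<Rightarrow> nat \<Rightarrow> (nat \<times> nat) set" where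
  "bars b k = (\<lambda>j. (b j, j)) ` {1..k}"

lemma bars_iff: "(i, j) \<in> bars b k \<longleftrightarrow> j \<in> {1..k} \<and> i = b j"
  by (auto simp: bars_def)

definition births_until :: "(nat \<times> nat) set \<Rightarrow> nat \<Rightarrow> nat set" where
  "births_until B m = {i. \<exists>j\<le>m. (i, j) \<in> B}"

lemma births_until_bars: "m \<le> k \<Longrightarrow> births_until (bars b k) m = b ` {1..m}"
  by (auto simp: births_until_def bars_def)

lemma card_bars: "card (bars b k) = k"
  unfolding bars_def by (subst card_image) (auto simp: inj_on_def)

lemma bars_subset_iff: "bars b k \<subseteq> bars c l \<longleftrightarrow> k \<le> l \<and> (\<forall>j\<in>{1..k}. b j = c j)"
proof -
  have "bars b k \<subseteq> bars c l \<longleftrightarrow> (\<forall>j\<in>{1..k}. j \<le> l \<and> b j = c j)"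
    by (auto simp: bars_def)
  then show ?thesis by (cases "k = 0") auto
qed

lemma extend_inj_to_permutation:
  fixes b :: "nat \<Rightarrow> nat"
  assumes S: "finite S" and A: "A \<subseteq> S" "inj_on b A" "b ` A \<subseteq> S"
  shows "\<exists>p. p permutes S \<and> (\<forall>x\<in>A. p x = b x)"
proof -
  \<comment> \<open>Complete \<open>b\<close> by any bijection \<open>h\<close> between the complements of its domain and its range.\<close>
  have "card (S - A) = card (S - b ` A)"
    using S A by (simp add: card_Diff_subset card_image finite_subset)
  then obtain h where h: "bij_betw h (S - A) (S - b ` A)"
    using S finite_same_card_bij by blast
  let ?p = "\<lambda>x. if x \<in> A then b x else if x \<in> S then h x else x"
  have "bij_betw ?p A (b ` A)" using A(2) by (auto simp: bij_betw_def inj_on_def)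
  moreover have "bij_betw ?p (S - A) (S - b ` A)"
    using h by (rule bij_betw_cong[THEN iffD1, rotated]) simp
  ultimately have "bij_betw ?p (A \<union> (S - A)) (b ` A \<union> (S - b ` A))"
    by (rule bij_betw_combine) blast
  moreover have "A \<union> (S - A) = S" "b ` A \<union> (S - b ` A) = S" using A by blast+
  ultimately have "?p permutes S" using A(1) by (intro bij_imp_permutes) auto
  then show ?thesis by (intro exI[of _ ?p]) simp
qed

text \<open>Any injection on \<open>{1..k}\<close> extends to a permutation, so partial barcodes need not be treated as
  truncations of full ones.\<close>

lemma PCB_iff_bars:
  "B \<in> carrier (PCB n) \<longleftrightarrow>
     (\<exists>k\<le>n. \<exists>b. inj_on b {1..k} \<and> b ` {1..k} \<subseteq> {1..n} \<and> B = bars b k)"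
proof
  assume "B \<in> carrier (PCB n)"
  then obtain \<sigma> k where \<sigma>: "\<sigma> permutes {1..n}" and k: "k \<le> n"
    and B: "B = partial_barcode {(i, \<sigma> i) | i. i \<in> {1..n}} k"
    by (auto simp: PCB_def barcode_def)
  have inv: "inv \<sigma> permutes {1..n}" using \<sigma> by (rule permutes_inv)
  have "B = bars (inv \<sigma>) k"
  proof (rule Set.set_eqI)
    fix x :: "nat \<times> nat"
    obtain i j where x: "x = (i, j)" by (cases x)
    have "x \<in> B \<longleftrightarrow> i \<in> {1..n} \<and> j = \<sigma> i \<and> j \<le> k"
      using x by (auto simp: B partial_barcode_def)
    also have "\<dots> \<longleftrightarrow> j \<in> {1..k} \<and> inv \<sigma> j = i"
      using permutes_in_image[OF \<sigma>, of i] k permutes_inv_eq[OF \<sigma>, of j i] by auto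
    also have "\<dots> \<longleftrightarrow> x \<in> bars (inv \<sigma>) k" using x by (auto simp: bars_def)
    finally show "x \<in> B \<longleftrightarrow> x \<in> bars (inv \<sigma>) k" .
  qed
  moreover have "inj_on (inv \<sigma>) {1..k}" using inv by (rule permutes_inj_on)
  moreover have "inv \<sigma> ` {1..k} \<subseteq> {1..n}" using permutes_in_image[OF inv] k by fastforce
  ultimately show "\<exists>k\<le>n. \<exists>b. inj_on b {1..k} \<and> b ` {1..k} \<subseteq> {1..n} \<and> B = bars b k"
    using k by blast
next
  assume "\<exists>k\<le>n. \<exists>b. inj_on b {1..k} \<and> b ` {1..k} \<subseteq> {1..n} \<and> B = bars b k"
  then obtain k b where k: "k \<le> n" and b: "inj_on b {1..k}" "b ` {1..k} \<subseteq> {1..n}"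
    and B: "B = bars b k" by blast
  obtain p where p: "p permutes {1..n}" "\<And>x. x \<in> {1..k} \<Longrightarrow> p x = b x"
    using extend_inj_to_permutation[of "{1..n}" "{1..k}" b] b k by auto
  have inv: "inv p permutes {1..n}" using p(1) by (rule permutes_inv)
  have "B = partial_barcode {(i, inv p i) | i. i \<in> {1..n}} k"
  proof (rule Set.set_eqI)
    fix x :: "nat \<times> nat"
    obtain i j where x: "x = (i, j)" by (cases x)
    have "x \<in> B \<longleftrightarrow> j \<in> {1..k} \<and> i = p j" using x p(2) by (auto simp: B bars_def)
    also have "\<dots> \<longleftrightarrow> i \<in> {1..n} \<and> j = inv p i \<and> j \<le> k"
      using permutes_in_image[OF inv, of i] k permutes_inv_eq[OF p(1), of i j] by auto
    also have "\<dots> \<longleftrightarrow> x \<in> partial_barcode {(i, inv p i) | i. i \<in> {1..n}} k"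
      using x by (auto simp: partial_barcode_def)
    finally show "x \<in> B \<longleftrightarrow> x \<in> partial_barcode {(i, inv p i) | i. i \<in> {1..n}} k" .
  qed
  moreover have "barcode n {(i, inv p i) | i. i \<in> {1..n}}"
    unfolding barcode_def using inv by blast
  ultimately show "B \<in> carrier (PCB n)" unfolding PCB_def using k by auto
qed

text \<open>The indices \<open>b j\<close> are distinct by counting: \<open>b\<close> maps \<open>{1..k}\<close> onto the set \<open>t k\<close>, which has \<open>k\<close>
  elements.  Both the surjectivity of the isomorphism and the fact that the Elder Rule
  yields a barcode rest on this.\<close>

lemma bars_of_rank_sequence:
  assumes t: "rank_sequence (subset_lattice n) card t k"
    and b: "\<And>j. j < k \<Longrightarrow> t (Suc j) = insert (b (Suc j)) (t j)"
  shows "bars b k \<in> carrier (PCB n)" "\<And>j. j \<le> k \<Longrightarrow> births_until (bars b k) j = t j"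
proof -
  have t_sub: "t j \<subseteq> {1..n}" and t_card: "card (t j) = j" if "j \<le> k" for j
    using t that by (auto simp: rank_sequence_def subset_lattice_def)
  have t_eq: "t j = b ` {1..j}" if "j \<le> k" for j
    using that
  proof (induction j)
    case 0
    have "finite (t 0)" using t_sub[of 0] finite_subset by blast
    then show ?case using t_card[of 0] by simp
  next
    case (Suc j)
    then show ?case using b[of j] by (simp add: atLeastAtMostSuc_conv)
  qed
  show "births_until (bars b k) j = t j" if "j \<le> k" for j
    using t_eq births_until_bars that by simp
  have "inj_on b {1..k}"
    using t_card[of k] t_eq[of k] by (intro eq_card_imp_inj_on) simp_all
  moreover have "k \<le> n"
    using card_mono[OF _ t_sub[of k]] t_card[of k] by simp
  ultimately show "bars b k \<in> carrier (PCB n)"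
    unfolding PCB_iff_bars using t_sub[of k] t_eq[of k] by auto
qed

lemma partial_order_PCB: "partial_order (PCB n)"
  unfolding PCB_def by (rule partial_order_eqI) auto

text \<open>The birth paired with \<open>j\<close> is the index by which stage \<open>j\<close> differs from stage \<open>j - 1\<close>.\<close>

lemma poset_iso_births_until:
  "poset_iso (PCB n) (path_poset (subset_lattice n)) (\<lambda>B. births_until B ` {..card B})"
proof (rule graded_poset.poset_iso_path_posetI[OF graded_poset_subset_lattice partial_order_PCB])
  fix B assume "B \<in> carrier (PCB n)"
  then obtain k b where k: "k \<le> n" and b: "inj_on b {1..k}" "b ` {1..k} \<subseteq> {1..n}"
    and B: "B = bars b k" unfolding PCB_iff_bars by blast
  have "births_until B j = b ` {1..j}" "b ` {1..j} \<subseteq> {1..n}" "card (b ` {1..j}) = j"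
    if "j \<le> k" for j
  proof -
    show "births_until B j = b ` {1..j}" using B that by (simp add: births_until_bars)
    have "{1..j} \<subseteq> {1..k}" using that by simp
    then show "b ` {1..j} \<subseteq> {1..n}" "card (b ` {1..j}) = j"
      using b inj_on_subset[OF b(1)] by (auto simp: card_image)
  qed
  moreover have "b ` {1..j} \<subseteq> b ` {1..Suc j}" for j
    by (intro image_mono) auto
  ultimately show "rank_sequence (subset_lattice n) card (births_until B) (card B)"
    by (simp add: rank_sequence_def subset_lattice_def B card_bars)
next
  fix B C assume "B \<in> carrier (PCB n)" "C \<in> carrier (PCB n)"
  then obtain k b l c where b: "inj_on b {1..k}" "B = bars b k"
    and c: "inj_on c {1..l}" "C = bars c l" unfolding PCB_iff_bars by blast
  have "b ` {1..j} = c ` {1..j}" if "\<forall>i\<in>{1..k}. b i = c i" "j \<le> k" for j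
    using that by (intro image_cong) auto
  moreover have "b j = c j" if img: "\<forall>j\<le>k. b ` {1..j} = c ` {1..j}" and j: "j \<in> {1..k}" for j
  proof -
    have "b j \<in> c ` {1..j}" using img j by (metis atLeastAtMost_iff image_eqI order_refl)
    then obtain i where i: "i \<in> {1..j}" "b j = c i" by blast
    then have "b j \<in> b ` {1..i}" using img j by auto
    then obtain i' where "i' \<in> {1..i}" "b j = b i'" by blast
    \<comment> \<open>\<open>b j\<close> already occurs among the first \<open>i\<close> values, which forces \<open>j \<le> i\<close>.\<close>
    then have "j = i'" using b(1) i j by (auto dest: inj_onD)
    then show ?thesis using i \<open>i' \<in> {1..i}\<close> by simp
  qed
  ultimately have "(k \<le> l \<and> (\<forall>j\<in>{1..k}. b j = c j)) \<longleftrightarrow>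
      k \<le> l \<and> (\<forall>j\<le>k. b ` {1..j} = c ` {1..j})" by blast
  then show "B \<sqsubseteq>\<^bsub>PCB n\<^esub> C \<longleftrightarrow>
      card B \<le> card C \<and> (\<forall>j\<le>card B. births_until B j = births_until C j)"
    by (simp add: b(2) c(2) card_bars bars_subset_iff births_until_bars PCB_def cong: conj_cong)
next
  fix t l assume t: "rank_sequence (subset_lattice n) card t l"
  have "\<exists>x. t (Suc j) = insert x (t j)" if j: "j < l" for j
  proof -
    have sub: "t j \<subseteq> t (Suc j)" and "t (Suc j) \<subseteq> {1..n}"
      and card: "card (t j) = j" "card (t (Suc j)) = Suc j"
      using t j by (simp_all add: rank_sequence_def subset_lattice_def)
    then have "finite (t (Suc j))" using finite_subset by blast
    then have "card (t (Suc j) - t j) = 1"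
      using sub card by (simp add: card_Diff_subset finite_subset[OF sub])
    then obtain x where "t (Suc j) - t j = {x}" by (auto simp: card_1_singleton_iff)
    then show ?thesis using sub by (intro exI[of _ x]) blast
  qed
  then obtain f where "\<And>j. j < l \<Longrightarrow> t (Suc j) = insert (f j) (t j)" by metis
  then have "\<And>j. j < l \<Longrightarrow> t (Suc j) = insert ((\<lambda>i. f (i - 1)) (Suc j)) (t j)" by simp
  note b = bars_of_rank_sequence[OF t this]
  show "\<exists>B\<in>carrier (PCB n). card B = l \<and> (\<forall>j\<le>l. births_until B j = t j)"
    using b card_bars by (intro bexI[OF _ b(1)]) simp
qed

section \<open>Merge forests\<close>

definition nodes :: "nat \<Rightarrow> nat \<Rightarrow> mnode set" where
  "nodes n k = Leaf ` {0..n} \<union> Merge ` {1..k}"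

definition arcs_below :: "(mnode \<times> mnode) set \<Rightarrow> nat \<Rightarrow> (mnode \<times> mnode) set" where
  "arcs_below E k = {(x, y) \<in> E. \<exists>i\<le>k. x = Merge i}"

definition leaves :: "(mnode \<times> mnode) set \<Rightarrow> mnode \<Rightarrow> nat set" where
  "leaves E v = {i. (v, Leaf i) \<in> E\<^sup>*}"

text \<open>One node for each connected component of the forest at stage \<open>k\<close>.\<close>

definition roots :: "nat \<Rightarrow> (mnode \<times> mnode) set \<Rightarrow> nat \<Rightarrow> mnode set" where
  "roots n E k = nodes n k - E `` (Merge ` {..k})"

text \<open>The partition of the leaves into connected components at stage \<open>k\<close>.\<close>

definition level :: "nat \<Rightarrow> (mnode \<times> mnode) set \<Rightarrow> nat \<Rightarrow> nat set set" where
  "level n E k = leaves E ` roots n E k"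

lemma nodes_0: "nodes n 0 = Leaf ` {0..n}"
  by (simp add: nodes_def)

lemma nodes_Suc: "nodes n (Suc k) = insert (Merge (Suc k)) (nodes n k)"
  by (simp add: nodes_def atLeastAtMostSuc_conv insert_commute)

lemma nodes_mono: "j \<le> k \<Longrightarrow> nodes n j \<subseteq> nodes n k"
  by (auto simp: nodes_def)

lemma Merge_in_nodes: "Merge j \<in> nodes n k \<longleftrightarrow> 1 \<le> j \<and> j \<le> k"
  by (auto simp: nodes_def)

lemma nodes_subset_iff: "nodes n j \<subseteq> nodes n k \<longleftrightarrow> j \<le> k"
proof
  assume sub: "nodes n j \<subseteq> nodes n k"
  show "j \<le> k"
  proof (cases "j = 0")
    case False
    then have "Merge j \<in> nodes n k" using sub by (intro subsetD[OF sub]) (simp add: Merge_in_nodes)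
    then show ?thesis by (simp add: Merge_in_nodes)
  qed simp
qed (rule nodes_mono)

lemma arcs_below_arcs_below: "j \<le> k \<Longrightarrow> arcs_below (arcs_below E k) j = arcs_below E j"
  by (auto simp: arcs_below_def)

lemma arcs_below_Suc:
  "arcs_below E (Suc k) = arcs_below E k \<union> Pair (Merge (Suc k)) ` (E `` {Merge (Suc k)})"
  by (auto simp: arcs_below_def le_Suc_eq)

lemma roots_iff: "v \<in> roots n E k \<longleftrightarrow> v \<in> nodes n k \<and> (\<forall>i\<le>k. (Merge i, v) \<notin> E)"
  by (auto simp: roots_def Image_iff)

lemma roots_arcs_below: "roots n (arcs_below E k) k = roots n E k"
  by (auto simp: roots_def arcs_below_def)

lemma merge_blocks_commute: "merge_blocks U Y Z = merge_blocks U Z Y"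
  by (simp add: merge_blocks_def Un_commute insert_commute)

text \<open>The arc sets of the stages of merge trees with \<open>n + 1\<close> leaves, described by local conditions and
  without reference to a full tree, so that they can be built up one merge at a time.  Children of
  the node \<open>j + 1\<close> come from stage \<open>j\<close>, which makes cycles impossible.\<close>

locale merge_forest =
  fixes n k :: nat and E :: "(mnode \<times> mnode) set"
  assumes arcD: "(x, y) \<in> E \<Longrightarrow> \<exists>j<k. x = Merge (Suc j) \<and> y \<in> nodes n j"
    and card_children: "j < k \<Longrightarrow> card (E `` {Merge (Suc j)}) = 2"
    and parent_unique: "(x, z) \<in> E \<Longrightarrow> (y, z) \<in> E \<Longrightarrow> x = y"
begin

lemma arcE:
  assumes "(x, y) \<in> E"
  obtains j where "j < k" "x = Merge (Suc j)" "y \<in> nodes n j"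
  using arcD[OF assms] by blast

lemma arcs_in_nodes: "(x, y) \<in> E \<Longrightarrow> x \<in> nodes n k \<and> y \<in> nodes n k"
proof (erule arcE)
  fix j assume "j < k" "x = Merge (Suc j)" "y \<in> nodes n j"
  then show "x \<in> nodes n k \<and> y \<in> nodes n k"
    using nodes_mono[of j k n] by (auto simp: Merge_in_nodes)
qed

lemma no_arc_from_Leaf: "(Leaf i, y) \<notin> E"
  by (auto elim: arcE)

lemma no_arc_from_Merge_0: "(Merge 0, y) \<notin> E"
  by (auto elim: arcE)

lemma arcs_below_all: "arcs_below E k = E"
proof -
  have "\<exists>i\<le>k. x = Merge i" if "(x, y) \<in> E" for x y
    using that by (rule arcE) (auto intro: Suc_leI)
  then show ?thesis by (auto simp: arcs_below_def)
qed

lemma merge_forest_arcs_below: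
  assumes "j \<le> k"
  shows "merge_forest n j (arcs_below E j)"
proof -
  have "arcs_below E j `` {Merge (Suc i)} = E `` {Merge (Suc i)}" if "i < j" for i
    using that by (auto simp: arcs_below_def)
  moreover have "x = y" if "(x, z) \<in> arcs_below E j" "(y, z) \<in> arcs_below E j" for x y z
    by (rule parent_unique[of x z]) (use that in \<open>auto simp: arcs_below_def\<close>)
  moreover have "\<exists>i<j. x = Merge (Suc i) \<and> y \<in> nodes n i" if "(x, y) \<in> arcs_below E j" for x y
    using that by (auto simp: arcs_below_def elim!: arcE)
  ultimately show ?thesis using card_children assms by unfold_locales simp_all
qed

lemma leaves_Leaf: "leaves E (Leaf i) = {i}"
  unfolding leaves_def by (auto elim: converse_rtranclE simp: no_arc_from_Leaf)

lemma leaves_Merge: "leaves E (Merge j) = (\<Union>c\<in>E `` {Merge j}. leaves E c)"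
proof -
  have "(Merge j, Leaf i) \<in> E\<^sup>* \<longleftrightarrow> (\<exists>c. (Merge j, c) \<in> E \<and> (c, Leaf i) \<in> E\<^sup>*)" for i
    by (metis converse_rtranclE converse_rtrancl_into_rtrancl mnode.distinct(1))
  then show ?thesis by (auto simp: leaves_def)
qed

text \<open>Arcs lead to smaller labels, so the descendants of a node of stage \<open>j\<close> are reached by arcs of
  stage \<open>j\<close>.\<close>

lemma leaves_arcs_below:
  assumes v: "v \<in> nodes n j"
  shows "leaves (arcs_below E j) v = leaves E v"
proof -
  have "(v, w) \<in> (arcs_below E j)\<^sup>*" if "(v, w) \<in> E\<^sup>*" for w
    using that v
  proof (induction rule: converse_rtrancl_induct)
    case (step x y)
    then obtain i where i: "x = Merge (Suc i)" "y \<in> nodes n i" by (auto elim: arcE)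
    then have "Suc i \<le> j" using step.prems by (simp add: Merge_in_nodes)
    then have "(x, y) \<in> arcs_below E j" "y \<in> nodes n j"
      using step.hyps(1) i nodes_mono[of i j n] by (auto simp: arcs_below_def)
    then show ?case using step.IH by (blast intro: converse_rtrancl_into_rtrancl)
  qed simp
  moreover have "arcs_below E j \<subseteq> E" by (auto simp: arcs_below_def)
  then have "(arcs_below E j)\<^sup>* \<subseteq> E\<^sup>*" by (rule rtrancl_mono)
  ultimately show ?thesis by (auto simp: leaves_def)
qed

lemma level_arcs_below: "level n (arcs_below E j) j = level n E j"
  unfolding level_def roots_arcs_below
  by (intro image_cong refl leaves_arcs_below) (auto simp: roots_def)

lemma roots_0: "roots n E 0 = Leaf ` {0..n}"
  by (auto simp: roots_def nodes_0 no_arc_from_Merge_0)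

lemma level_0: "level n E 0 = (\<lambda>x. {x}) ` {0..n}"
  by (simp add: level_def roots_0 image_image leaves_Leaf)

text \<open>By uniqueness of parents, a child of the node \<open>j + 1\<close> has no parent at an earlier stage.\<close>

lemma children_subset_roots: "E `` {Merge (Suc j)} \<subseteq> roots n E j"
proof
  fix c assume "c \<in> E `` {Merge (Suc j)}"
  then have c: "(Merge (Suc j), c) \<in> E" by simp
  then have "c \<in> nodes n j" by (auto elim: arcE)
  moreover have "(Merge i, c) \<notin> E" if "i \<le> j" for i
    using parent_unique[OF c] that by fastforce
  ultimately show "c \<in> roots n E j" by (auto simp: roots_def)
qed

lemma roots_Suc:
  assumes "j < k"
  shows "roots n E (Suc j) = insert (Merge (Suc j)) (roots n E j - E `` {Merge (Suc j)})"
proof -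
  have "(Merge i, Merge (Suc j)) \<notin> E" if "i \<le> Suc j" for i
    using that by (auto elim!: arcE simp: Merge_in_nodes)
  then show ?thesis
    by (intro Set.set_eqI) (auto simp: roots_iff nodes_Suc le_Suc_eq)
qed

lemma level_Suc:
  assumes j: "j < k" and inj: "inj_on (leaves E) (roots n E j)"
  shows "\<exists>c d. E `` {Merge (Suc j)} = {c, d} \<and> c \<in> roots n E j \<and> d \<in> roots n E j \<and>
     leaves E c \<noteq> leaves E d \<and>
     level n E (Suc j) = merge_blocks (level n E j) (leaves E c) (leaves E d)"
proof -
  obtain c d where ch: "E `` {Merge (Suc j)} = {c, d}" and "c \<noteq> d"
    using card_children[OF j] by (auto simp: card_2_iff)
  then have r: "c \<in> roots n E j" "d \<in> roots n E j" using children_subset_roots[of j] by auto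
  have "leaves E ` (roots n E j - {c, d}) = level n E j - {leaves E c, leaves E d}"
    using inj_on_image_set_diff[OF inj, of "roots n E j" "{c, d}"] r by (simp add: level_def)
  then have "level n E (Suc j) = merge_blocks (level n E j) (leaves E c) (leaves E d)"
    by (simp add: level_def roots_Suc[OF j] ch leaves_Merge merge_blocks_def)
  moreover have "leaves E c \<noteq> leaves E d" using inj r \<open>c \<noteq> d\<close> by (simp add: inj_on_eq_iff)
  ultimately show ?thesis using ch r by blast
qed

text \<open>The two halves are proved together: the new root \<open>j + 1\<close> has as leaf set the union of two blocks,
  and such a union is not itself a block, so leaf sets stay distinct on the roots.\<close>

lemma level_partition:
  assumes "j \<le> k"
  shows "inj_on (leaves E) (roots n E j) \<and> partition_on {0..n} (level n E j)"
  using assms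
proof (induction j)
  case 0
  then show ?case
    by (simp only: level_0 roots_0 partition_on_singletons) (auto simp: inj_on_def leaves_Leaf)
next
  case (Suc j)
  then have j: "j < k" and inj: "inj_on (leaves E) (roots n E j)"
    and part: "partition_on {0..n} (level n E j)" by auto
  obtain c d where cd: "E `` {Merge (Suc j)} = {c, d}" "c \<in> roots n E j" "d \<in> roots n E j"
      "leaves E c \<noteq> leaves E d"
    and level: "level n E (Suc j) = merge_blocks (level n E j) (leaves E c) (leaves E d)"
    using level_Suc[OF j inj] by blast
  have blocks: "leaves E c \<in> level n E j" "leaves E d \<in> level n E j"
    using cd(2,3) by (simp_all add: level_def)
  have "leaves E (Merge (Suc j)) \<notin> level n E j"
    using union_of_blocks_notin_partition[OF part blocks cd(4)] by (simp add: leaves_Merge cd(1))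
  moreover define R where "R = roots n E j - E `` {Merge (Suc j)}"
  ultimately have "leaves E (Merge (Suc j)) \<notin> leaves E ` R" by (auto simp: level_def)
  moreover have "inj_on (leaves E) R" unfolding R_def by (rule inj_on_diff[OF inj])
  ultimately have "inj_on (leaves E) (roots n E (Suc j))"
    unfolding roots_Suc[OF j] R_def[symmetric] by auto
  moreover have "partition_on {0..n} (level n E (Suc j))"
    unfolding level using refines_merge_blocks[OF part blocks cd(4)] by (simp add: refines_def)
  ultimately show ?case by blast
qed

lemmas inj_on_leaves = level_partition[THEN conjunct1]
lemmas partition_on_level = level_partition[THEN conjunct2]

text \<open>The children are listed with the older branch first, as the Elder Rule requires.\<close>

lemma level_SucE:
  assumes j: "j < k"
  obtains c d where "E `` {Merge (Suc j)} = {c, d}" "c \<in> roots n E j" "d \<in> roots n E j"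
    "Min (leaves E c) < Min (leaves E d)"
    "level n E (Suc j) = merge_blocks (level n E j) (leaves E c) (leaves E d)"
proof -
  have jk: "j \<le> k" using j by simp
  obtain c d where cd: "E `` {Merge (Suc j)} = {c, d}" "c \<in> roots n E j" "d \<in> roots n E j"
      "leaves E c \<noteq> leaves E d"
    and level: "level n E (Suc j) = merge_blocks (level n E j) (leaves E c) (leaves E d)"
    using level_Suc[OF j inj_on_leaves[OF jk]] by blast
  have "Min (leaves E c) \<noteq> Min (leaves E d)"
    using inj_on_Min_partition[OF partition_on_level[OF jk]] cd(2-4)
    by (simp add: level_def inj_on_eq_iff)
  then consider "Min (leaves E c) < Min (leaves E d)" | "Min (leaves E d) < Min (leaves E c)"
    by linarith
  then show ?thesis
  proof cases
    case 1
    then show ?thesis using that cd level by blast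
  next
    case 2
    have "E `` {Merge (Suc j)} = {d, c}" using cd(1) by auto
    then show ?thesis using that[of d c] 2 cd(2,3) level merge_blocks_commute by metis
  qed
qed

text \<open>A merge removes the two blocks that it joins and keeps all others, so the levels determine the
  arcs.\<close>

lemma children_eq:
  assumes j: "j < k"
  shows "E `` {Merge (Suc j)} = {v \<in> roots n E j. leaves E v \<notin> level n E (Suc j)}"
proof -
  obtain c d where cd: "E `` {Merge (Suc j)} = {c, d}" "c \<in> roots n E j" "d \<in> roots n E j"
      "Min (leaves E c) < Min (leaves E d)"
    and level: "level n E (Suc j) = merge_blocks (level n E j) (leaves E c) (leaves E d)"
    by (rule level_SucE[OF j])
  have jk: "j \<le> k" using j by simp
  have union: "leaves E c \<union> leaves E d \<notin> level n E j"
    by (rule union_of_blocks_notin_partition[OF partition_on_level[OF jk]])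
      (use cd in \<open>auto simp: level_def\<close>)
  have "leaves E v \<notin> level n E (Suc j) \<longleftrightarrow> v = c \<or> v = d" if v: "v \<in> roots n E j" for v
  proof -
    have "leaves E v \<in> level n E j" using v by (simp add: level_def)
    then have "leaves E v \<notin> level n E (Suc j) \<longleftrightarrow> leaves E v = leaves E c \<or> leaves E v = leaves E d"
      using union by (auto simp: level merge_blocks_def)
    then show ?thesis using inj_on_leaves[OF jk] v cd(2,3) by (simp add: inj_on_eq_iff)
  qed
  then have "{v \<in> roots n E j. leaves E v \<notin> level n E (Suc j)} = {v \<in> roots n E j. v = c \<or> v = d}"
    by (intro Collect_cong conj_cong refl)
  also have "\<dots> = E `` {Merge (Suc j)}" unfolding cd(1) using cd(2,3) by auto
  finally show ?thesis by simp
qed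

lemma rank_sequence_level:
  "rank_sequence (partition_lattice n) (partition_rank n) (level n E) k"
proof -
  have step: "refines {0..n} (level n E j) (level n E (Suc j)) \<and>
      partition_rank n (level n E (Suc j)) = Suc (partition_rank n (level n E j))" if j: "j < k" for j
  proof -
    obtain c d where "E `` {Merge (Suc j)} = {c, d}"
      and cd: "c \<in> roots n E j" "d \<in> roots n E j" "Min (leaves E c) < Min (leaves E d)"
      and level: "level n E (Suc j) = merge_blocks (level n E j) (leaves E c) (leaves E d)"
      by (rule level_SucE[OF j])
    have part: "partition_on {0..n} (level n E j)" using partition_on_level j by simp
    have blocks: "leaves E c \<in> level n E j" "leaves E d \<in> level n E j" "leaves E c \<noteq> leaves E d"
      using cd by (auto simp: level_def)
    show ?thesis
      unfolding level
      using refines_merge_blocks[OF part blocks] partition_rank_merge_blocks[OF part blocks] by blast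
  qed
  have "partition_rank n (level n E j) = j" if "j \<le> k" for j
    using that
  proof (induction j)
    case 0
    show ?case by (simp add: level_0 card_image)
  next
    case (Suc j)
    then show ?case using step[of j] by simp
  qed
  then show ?thesis
    using step partition_on_level by (simp add: rank_sequence_def partition_lattice_def)
qed

lemma card_roots:
  assumes "j \<le> k"
  shows "card (roots n E j) = Suc n - j"
proof -
  have "card (roots n E j) = card (level n E j)"
    unfolding level_def using card_image[OF inj_on_leaves[OF assms]] by simp
  moreover have "partition_rank n (level n E j) = j"
    using rank_sequence_level assms by (simp add: rank_sequence_def)
  ultimately show ?thesis
    using card_partition_le[OF partition_on_level[OF assms]] by linarith
qed

lemma no_arc_to_root: "v \<in> roots n E k \<Longrightarrow> (x, v) \<notin> E"
  using arcD[of x v] by (auto simp: roots_iff dest: Suc_leI)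

text \<open>Any two roots may be merged next; this realizes every possible continuation of a path of
  partitions by a forest.\<close>

lemma add_merge:
  assumes cd: "c \<in> roots n E k" "d \<in> roots n E k" "c \<noteq> d"
  defines "E' \<equiv> E \<union> {(Merge (Suc k), c), (Merge (Suc k), d)}"
  shows "merge_forest n (Suc k) E'" "arcs_below E' k = E"
    and "level n E' (Suc k) = merge_blocks (level n E k) (leaves E c) (leaves E d)"
proof -
  have no_parent: "(x, c) \<notin> E" "(x, d) \<notin> E" for x
    using cd(1,2) by (auto dest: no_arc_to_root)
  have new: "(Merge (Suc k), y) \<notin> E" for y by (auto elim: arcE)
  have ch: "E' `` {Merge (Suc k)} = {c, d}" using new by (auto simp: E'_def)
  have ch': "E' `` {Merge (Suc j)} = E `` {Merge (Suc j)}" if "j < k" for j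
    using that by (auto simp: E'_def)
  have cdn: "c \<in> nodes n k" "d \<in> nodes n k" using cd by (auto simp: roots_def)
  show f: "merge_forest n (Suc k) E'"
  proof
    show "\<exists>j<Suc k. x = Merge (Suc j) \<and> y \<in> nodes n j" if "(x, y) \<in> E'" for x y
    proof -
      have "(x, y) \<in> E \<or> x = Merge (Suc k) \<and> y \<in> nodes n k"
        using that cdn unfolding E'_def by blast
      then show ?thesis using arcD[of x y] less_SucI by blast
    qed
    show "card (E' `` {Merge (Suc j)}) = 2" if "j < Suc k" for j
    proof (cases "j = k")
      case True
      then show ?thesis using ch cd(3) by simp
    next
      case False
      then show ?thesis using that ch'[of j] card_children[of j] by simp
    qed
    show "x = y" if "(x, z) \<in> E'" "(y, z) \<in> E'" for x y z
    proof (cases "z = c \<or> z = d")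
      case True
      then show ?thesis using that no_parent cd(3) by (auto simp: E'_def)
    next
      case False
      then have "(x, z) \<in> E" "(y, z) \<in> E" using that by (auto simp: E'_def)
      then show ?thesis by (rule parent_unique)
    qed
  qed
  have "arcs_below E' k = arcs_below E k" by (auto simp: E'_def arcs_below_def)
  then show below: "arcs_below E' k = E" by (simp only: arcs_below_all)
  interpret E': merge_forest n "Suc k" E' by (rule f)
  have lv: "leaves E' v = leaves E v" if "v \<in> nodes n k" for v
    using E'.leaves_arcs_below[OF that] by (simp add: below)
  have levels: "level n E' k = level n E k"
    using E'.level_arcs_below[of k] by (simp add: below)
  obtain x y where xy: "E' `` {Merge (Suc k)} = {x, y}"
    and "x \<in> roots n E' k" "y \<in> roots n E' k" "Min (leaves E' x) < Min (leaves E' y)"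
    and level: "level n E' (Suc k) = merge_blocks (level n E' k) (leaves E' x) (leaves E' y)"
    by (rule E'.level_SucE[OF lessI])
  have "x = c \<and> y = d \<or> x = d \<and> y = c" using xy ch by (auto simp: doubleton_eq_iff)
  then show "level n E' (Suc k) = merge_blocks (level n E k) (leaves E c) (leaves E d)"
    using level levels lv cdn merge_blocks_commute by metis
qed

text \<open>As long as fewer than \<open>n\<close> merges have taken place, at least two roots remain.\<close>

lemma extend_to_full:
  assumes "k \<le> m" "m \<le> n"
  shows "\<exists>E'. merge_forest n m E' \<and> arcs_below E' k = E"
  using assms
proof (induction m rule: dec_induct)
  case base
  then show ?case using merge_forest_axioms arcs_below_all by blast
next
  case (step m)
  then obtain E' where E': "merge_forest n m E'" "arcs_below E' k = E" by auto
  interpret E': merge_forest n m E' by (rule E'(1))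
  have "card (roots n E' m) = Suc n - m" by (rule E'.card_roots) simp
  then have "2 \<le> card (roots n E' m)" using step.prems by simp
  then obtain S where "S \<subseteq> roots n E' m" "card S = 2"
    by (rule obtain_subset_with_card_n)
  then obtain c d where cd: "c \<in> roots n E' m" "d \<in> roots n E' m" "c \<noteq> d"
    by (auto simp: card_2_iff)
  let ?E = "E' \<union> {(Merge (Suc m), c), (Merge (Suc m), d)}"
  have "arcs_below ?E k = arcs_below (arcs_below ?E m) k"
    using step.hyps by (simp add: arcs_below_arcs_below)
  also have "\<dots> = E" by (simp only: E'.add_merge(2)[OF cd] E'(2))
  finally show ?case using E'.add_merge(1)[OF cd] by blast
qed

end

text \<open>Once the arcs below stage \<open>j\<close> agree, so do the roots and their leaf sets, and the next pair of
  children is read off from the levels.\<close>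

lemma arcs_below_determined_by_levels:
  assumes E: "merge_forest n k E" and E': "merge_forest n k' E'"
    and "j \<le> k" "j \<le> k'" "\<forall>i\<le>j. level n E i = level n E' i"
  shows "arcs_below E j = arcs_below E' j"
proof -
  interpret E: merge_forest n k E by (rule E)
  interpret E': merge_forest n k' E' by (rule E')
  show ?thesis
    using assms(3-5)
  proof (induction j)
    case 0
    show ?case
      by (auto simp: arcs_below_def E.no_arc_from_Merge_0 E'.no_arc_from_Merge_0)
  next
    case (Suc j)
    then have IH: "arcs_below E j = arcs_below E' j" by simp
    then have roots: "roots n E j = roots n E' j" by (metis roots_arcs_below)
    have "leaves E v = leaves E' v" if "v \<in> roots n E j" for v
      using that E.leaves_arcs_below[of v j] E'.leaves_arcs_below[of v j] IH by (simp add: roots_def)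
    then have "E `` {Merge (Suc j)} = E' `` {Merge (Suc j)}"
      using Suc.prems E.children_eq[of j] E'.children_eq[of j] roots by auto
    then show ?case by (simp only: arcs_below_Suc IH)
  qed
qed

text \<open>A forest that is contained in another one is a truncation of it, because each node has exactly two
  children in both; this turns containment into the prefix order.\<close>

lemma merge_forest_subset_iff_levels:
  assumes E: "merge_forest n k E" and E': "merge_forest n k' E'" and le: "k \<le> k'"
  shows "E \<subseteq> E' \<longleftrightarrow> (\<forall>j\<le>k. level n E j = level n E' j)"
proof -
  interpret E: merge_forest n k E by (rule E)
  interpret E': merge_forest n k' E' by (rule E')
  have below: "arcs_below E' k = E" if sub: "E \<subseteq> E'"
  proof
    have "arcs_below E k \<subseteq> arcs_below E' k" using sub by (auto simp: arcs_below_def)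
    then show "E \<subseteq> arcs_below E' k" by (simp only: E.arcs_below_all)
    show "arcs_below E' k \<subseteq> E"
    proof
      fix x assume "x \<in> arcs_below E' k"
      then obtain i y where i: "i \<le> k" and x: "x = (Merge i, y)" "x \<in> E'"
        unfolding arcs_below_def by blast
      obtain j where "i = Suc j" using E'.arcD[of "Merge i" y] x by auto
      then have j: "j < k" and x: "x = (Merge (Suc j), y)" "x \<in> E'" using i x by auto
      have "card (E' `` {Merge (Suc j)}) = 2" "card (E `` {Merge (Suc j)}) = 2"
        using E.card_children E'.card_children j le by auto
      moreover from this have "finite (E' `` {Merge (Suc j)})" by (intro card_ge_0_finite) simp
      ultimately have "E `` {Merge (Suc j)} = E' `` {Merge (Suc j)}"
        using sub by (intro card_subset_eq) auto
      then show "x \<in> E" using x by blast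
    qed
  qed
  show ?thesis
  proof
    assume "E \<subseteq> E'"
    then have "arcs_below E j = arcs_below E' j" if "j \<le> k" for j
      using below arcs_below_arcs_below[OF that, of E'] by simp
    then show "\<forall>j\<le>k. level n E j = level n E' j"
      using E.level_arcs_below E'.level_arcs_below by metis
  next
    assume "\<forall>j\<le>k. level n E j = level n E' j"
    then have "arcs_below E k = arcs_below E' k"
      using arcs_below_determined_by_levels[OF E E' _ le] by simp
    moreover have "arcs_below E' k \<subseteq> E'" by (auto simp: arcs_below_def)
    ultimately show "E \<subseteq> E'" by (simp only: E.arcs_below_all)
  qed
qed

lemma ex_merge_forest_levels:
  assumes "rank_sequence (partition_lattice n) (partition_rank n) t l"
  shows "\<exists>E. merge_forest n l E \<and> (\<forall>j\<le>l. level n E j = t j)"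
  using assms
proof (induction l)
  case 0
  interpret P: graded_poset "partition_lattice n" "partition_rank n" n
    by (rule graded_poset_partition_lattice)
  interpret E: merge_forest n 0 "{}" by unfold_locales auto
  have "t 0 = (\<lambda>x. {x}) ` {0..n}"
    using 0 P.rank_0_iff[of "t 0"] bottom_partition_lattice by (simp add: rank_sequence_def)
  then show ?case using E.merge_forest_axioms E.level_0 by auto
next
  case (Suc l)
  then obtain E where E: "merge_forest n l E" and levels: "\<forall>j\<le>l. level n E j = t j"
    using rank_sequence_prefix[OF Suc.prems, of l] by auto
  interpret E: merge_forest n l E by (rule E)
  obtain Y Z where YZ: "Y \<in> level n E l" "Z \<in> level n E l" "Y \<noteq> Z"
    and t: "t (Suc l) = merge_blocks (level n E l) Y Z"
    using partition_rank_sequence_Suc[OF Suc.prems, of l] levels by auto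
  obtain c d where cd: "c \<in> roots n E l" "d \<in> roots n E l" "Y = leaves E c" "Z = leaves E d" "c \<noteq> d"
    using YZ by (auto simp: level_def)
  note add = E.add_merge[OF cd(1,2,5)]
  let ?E = "E \<union> {(Merge (Suc l), c), (Merge (Suc l), d)}"
  have "level n ?E j = level n E j" if "j \<le> l" for j
    using merge_forest_subset_iff_levels[OF E add(1)] that by auto
  moreover have "level n ?E (Suc l) = t (Suc l)" using add(3) t cd(3,4) by simp
  ultimately show ?case using add(1) levels by (intro exI[of _ ?E]) (auto simp: le_Suc_eq)
qed

section \<open>Merge trees as merge forests\<close>

fun first_stage :: "mnode \<Rightarrow> nat" where
  "first_stage (Leaf i) = 0"
| "first_stage (Merge j) = j"

lemma out_arcs_with_proj: "out_arcs (with_proj T) v = Pair v ` (parcs T `` {v})"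
  by (auto simp: out_arcs_def)

lemma out_degree_with_proj: "out_degree (with_proj T) v = card (parcs T `` {v})"
  unfolding out_degree_def out_arcs_with_proj by (intro card_image) (auto simp: inj_on_def)

lemma merge_forest_if_merge_tree:
  assumes T: "merge_tree n T"
  shows "merge_forest n n (parcs T)"
proof -
  obtain r where r: "rooted_tree (with_proj T) r" using T by (auto simp: merge_tree_def)
  interpret G: wf_digraph "with_proj T" using r by (simp add: rooted_tree_def)
  have verts: "pverts T = nodes n n" using T by (simp add: merge_tree_def nodes_def)
  have ends: "x \<in> nodes n n" "y \<in> nodes n n" if "(x, y) \<in> parcs T" for x y
    using G.tail_in_verts[of "(x, y)"] G.head_in_verts[of "(x, y)"] that by (simp_all add: verts)
  have finite_children: "finite (parcs T `` {x})" for x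
  proof (rule finite_subset)
    show "parcs T `` {x} \<subseteq> nodes n n" using ends by blast
  qed (simp add: nodes_def)
  show ?thesis
  proof
    fix x y assume xy: "(x, y) \<in> parcs T"
    have "x \<noteq> Leaf i" for i
    proof
      assume x: "x = Leaf i"
      then have "i \<in> {0..n}" using ends(1)[OF xy] by (auto simp: nodes_def)
      then have "card (parcs T `` {x}) = 0"
        using T x by (auto simp: merge_tree_def out_degree_with_proj)
      then show False using finite_children[of x] xy by auto
    qed
    then obtain j where x: "x = Merge (Suc j)" "j < n"
      using ends(1)[OF xy] by (auto simp: nodes_def dest!: Suc_le_D)
    have "i < Suc j" if "y = Merge i" for i
      using T xy x that by (auto simp: merge_tree_def)
    then have "y \<in> nodes n j" using ends(2)[OF xy] by (auto simp: nodes_def)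
    then show "\<exists>j<n. x = Merge (Suc j) \<and> y \<in> nodes n j" using x by blast
  next
    fix j assume "j < n"
    then show "card (parcs T `` {Merge (Suc j)}) = 2"
      using T by (auto simp: merge_tree_def out_degree_with_proj)
  next
    \<comment> \<open>Two parents of \<open>z\<close> would yield two walks from the root to \<open>z\<close>.\<close>
    fix x y z assume arcs: "(x, z) \<in> parcs T" "(y, z) \<in> parcs T"
    have ex1: "\<exists>!p. G.awalk r p v" if "v \<in> nodes n n" for v
      using r that by (simp add: rooted_tree_def verts)
    obtain p where p: "G.awalk r p x" using ex1[OF ends(1)[OF arcs(1)]] by (rule ex1E)
    obtain q where q: "G.awalk r q y" using ex1[OF ends(1)[OF arcs(2)]] by (rule ex1E)
    have "G.awalk x [(x, z)] z" "G.awalk y [(y, z)] z"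
      using arcs ends[OF arcs(1)] ends[OF arcs(2)] by (simp_all add: G.awalk_simps verts)
    then have "G.awalk r (p @ [(x, z)]) z" "G.awalk r (q @ [(y, z)]) z"
      using G.awalk_appendI p q by blast+
    then have "p @ [(x, z)] = q @ [(y, z)]"
      using ex1[OF ends(2)[OF arcs(1)]] by blast
    then show "x = y" by simp
  qed
qed

text \<open>After \<open>n\<close> merges a single root remains.  Every other node has a parent with a larger label, so
  climbing up ends at the root, and the climb is unique because parents are.\<close>

lemma merge_tree_if_merge_forest:
  assumes E: "merge_forest n n (parcs T)" and verts: "pverts T = nodes n n"
  shows "merge_tree n T"
proof -
  interpret E: merge_forest n n "parcs T" by (rule E)
  interpret G: wf_digraph "with_proj T"
    by standard (use E.arcs_in_nodes verts in auto)
  have "card (roots n (parcs T) n) = 1" using E.card_roots[of n] by simp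
  then obtain r where r: "roots n (parcs T) n = {r}" by (auto simp: card_1_singleton_iff)
  then have r_node: "r \<in> nodes n n" by (auto simp: roots_def)
  have no_arc_to_r: "(x, r) \<notin> parcs T" for x using E.no_arc_to_root r by blast
  have walk: "\<exists>p. G.awalk r p v" if "v \<in> nodes n n" for v
    using that
  proof (induction "n - first_stage v" arbitrary: v rule: less_induct)
    case less
    show ?case
    proof (cases "v = r")
      case True
      then show ?thesis
        using r_node verts by (intro exI[of _ "[]"]) (simp add: G.awalk_simps)
    next
      case False
      then have "v \<notin> roots n (parcs T) n" using r by simp
      then obtain i where i: "(Merge i, v) \<in> parcs T" "i \<le> n"
        using less.prems by (auto simp: roots_iff)
      have "first_stage v < i" using E.arcD[OF i(1)] by (auto simp: nodes_def)
      then have "n - first_stage (Merge i) < n - first_stage v" using i(2) by simp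
      then obtain p where "G.awalk r p (Merge i)"
        using less.hyps E.arcs_in_nodes[OF i(1)] by blast
      moreover have "G.awalk (Merge i) [(Merge i, v)] v"
        using i(1) E.arcs_in_nodes[OF i(1)] by (auto simp: G.awalk_simps verts)
      ultimately show ?thesis by (blast intro: G.awalk_appendI)
    qed
  qed
  have last_arc: "\<exists>x. (x, v) \<in> parcs T \<and> G.awalk r (butlast p) x \<and> p = butlast p @ [(x, v)]"
    if "G.awalk r p v" "p \<noteq> []" for p v
  proof -
    have p: "p = butlast p @ [last p]" using that by simp
    then have "G.awalk r (butlast p @ [last p]) v" using that by simp
    then show ?thesis
      using p by (cases "last p") (auto simp: G.awalk_append_iff G.awalk_simps)
  qed
  have unique: "p = q" if "G.awalk r p v" "G.awalk r q v" for p q v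
    using that
  proof (induction "length p" arbitrary: p q v)
    case 0
    then have "v = r" by (simp add: G.awalk_simps)
    then have "q = []" using last_arc[of q v] 0 no_arc_to_r by blast
    then show ?case using 0 by simp
  next
    case (Suc m)
    then have "p \<noteq> []" by auto
    then obtain x where x: "(x, v) \<in> parcs T" "G.awalk r (butlast p) x" "p = butlast p @ [(x, v)]"
      using last_arc Suc.prems(1) by blast
    then have "v \<noteq> r" using no_arc_to_r by blast
    then have "q \<noteq> []" using Suc.prems(2) by (auto simp: G.awalk_simps)
    then obtain y where y: "(y, v) \<in> parcs T" "G.awalk r (butlast q) y" "q = butlast q @ [(y, v)]"
      using last_arc Suc.prems(2) by blast
    have "x = y" using E.parent_unique x(1) y(1) by blast
    moreover have "m = length (butlast p)" using Suc.hyps(2) by simp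
    ultimately have "butlast p = butlast q" using Suc.hyps(1) x(2) y(2) by blast
    then show ?case using x(3) y(3) \<open>x = y\<close> by metis
  qed
  have "rooted_tree (with_proj T) r"
    unfolding rooted_tree_def using G.wf_digraph_axioms r_node walk unique verts by (auto 0 3)
  moreover have "out_degree (with_proj T) (Leaf i) = 0" for i
  proof -
    have "parcs T `` {Leaf i} = {}" using E.no_arc_from_Leaf by blast
    then show ?thesis by (simp add: out_degree_with_proj)
  qed
  moreover have "out_degree (with_proj T) (Merge j) = 2" if "j \<in> {1..n}" for j
  proof -
    have "j - 1 < n" "Suc (j - 1) = j" using that by auto
    then show ?thesis using E.card_children[of "j - 1"] by (simp add: out_degree_with_proj)
  qed
  moreover have "j' < j" if "(Merge j, Merge j') \<in> parcs T" for j j'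
    using E.arcD[OF that] by (auto simp: Merge_in_nodes)
  ultimately show ?thesis
    unfolding merge_tree_def using verts by (auto simp: nodes_def)
qed

section \<open>Partial merge trees are based paths of partitions\<close>

definition forest_graph :: "nat \<Rightarrow> nat \<Rightarrow> (mnode \<times> mnode) set \<Rightarrow> mgraph" where
  "forest_graph n k E = \<lparr>verts = nodes n k, arcs = E, tail = fst, head = snd\<rparr>"

definition forest_filtration :: "nat \<Rightarrow> nat \<Rightarrow> (mnode \<times> mnode) set \<Rightarrow> mgraph list" where
  "forest_filtration n k E = map (\<lambda>j. forest_graph n j (arcs_below E j)) [0..<Suc k]"

lemma arcs_forest_graph [simp]: "arcs (forest_graph n k E) = E"
  by (simp add: forest_graph_def)

lemma length_forest_filtration: "length (forest_filtration n k E) = Suc k"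
  by (simp add: forest_filtration_def)

lemma forest_filtration_arcs_below:
  "forest_filtration n k (arcs_below E k) = forest_filtration n k E"
  unfolding forest_filtration_def by (intro map_cong refl) (auto simp: arcs_below_arcs_below)

lemma (in merge_forest) last_forest_filtration:
  "last (forest_filtration n k E) = forest_graph n k E"
  by (simp add: forest_filtration_def arcs_below_all)

lemma (in merge_forest) wf_digraph_forest_graph: "wf_digraph (forest_graph n k E)"
  by standard (use arcs_in_nodes in \<open>auto simp: forest_graph_def\<close>)

lemma tree_stage_eq_forest_graph:
  assumes E: "merge_forest n n (parcs T)" and k: "k \<le> n"
  shows "tree_stage n T k = forest_graph n k (arcs_below (parcs T) k)"
proof -
  interpret E: merge_forest n n "parcs T" by (rule E)
  interpret B: merge_forest n k "arcs_below (parcs T) k" by (rule E.merge_forest_arcs_below[OF k])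
  have "e \<in> arcs_below (parcs T) k \<longleftrightarrow> e \<in> parcs T \<and> fst e \<in> nodes n k \<and> snd e \<in> nodes n k" for e
  proof -
    obtain x y where e: "e = (x, y)" by (cases e)
    have "e \<in> arcs_below (parcs T) k" if "e \<in> parcs T" "x \<in> nodes n k"
      using E.arcD[of x y] that e by (auto simp: arcs_below_def Merge_in_nodes)
    moreover have "arcs_below (parcs T) k \<subseteq> parcs T" by (auto simp: arcs_below_def)
    ultimately show ?thesis using B.arcs_in_nodes[of x y] e by auto
  qed
  then have "arcs_below (parcs T) k = {e \<in> parcs T. fst e \<in> nodes n k \<and> snd e \<in> nodes n k}"
    by blast
  then show ?thesis
    by (simp add: tree_stage_def forest_graph_def induce_subgraph_def nodes_def)
qed

text \<open>A merge forest extends to a merge tree, so partial merge trees can be handled without a choice of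
  the full tree.\<close>

lemma PCT_iff_forest_filtration:
  "F \<in> carrier (PCT n) \<longleftrightarrow> (\<exists>k\<le>n. \<exists>E. merge_forest n k E \<and> F = forest_filtration n k E)"
proof
  assume "F \<in> carrier (PCT n)"
  then obtain T k where T: "merge_tree n T" and k: "k \<le> n" and F: "F = partial_merge_tree n T k"
    by (auto simp: PCT_def)
  have E: "merge_forest n n (parcs T)" using T by (rule merge_forest_if_merge_tree)
  have "F = forest_filtration n k (parcs T)"
    unfolding F partial_merge_tree_def forest_filtration_def
    using k by (intro map_cong refl tree_stage_eq_forest_graph[OF E]) auto
  then show "\<exists>k\<le>n. \<exists>E. merge_forest n k E \<and> F = forest_filtration n k E"
    using merge_forest.merge_forest_arcs_below[OF E k] k forest_filtration_arcs_below by metis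
next
  assume "\<exists>k\<le>n. \<exists>E. merge_forest n k E \<and> F = forest_filtration n k E"
  then obtain k E where k: "k \<le> n" and E: "merge_forest n k E" and F: "F = forest_filtration n k E"
    by blast
  obtain E' where E': "merge_forest n n E'" "arcs_below E' k = E"
    using merge_forest.extend_to_full[OF E k] by blast
  define T where "T = \<lparr>pverts = nodes n n, parcs = E'\<rparr>"
  have "merge_tree n T"
    by (rule merge_tree_if_merge_forest) (simp_all add: T_def E')
  moreover have "F = partial_merge_tree n T k"
    unfolding F partial_merge_tree_def E'(2)[symmetric] forest_filtration_arcs_below
    unfolding forest_filtration_def
    using k E'(1) by (intro map_cong refl) (auto simp: tree_stage_eq_forest_graph T_def)
  ultimately show "F \<in> carrier (PCT n)" using k by (auto simp: PCT_def)
qed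

lemma le_PCT_forest_filtration:
  assumes E: "merge_forest n k E" and E': "merge_forest n k' E'"
  shows "forest_filtration n k E \<sqsubseteq>\<^bsub>PCT n\<^esub> forest_filtration n k' E' \<longleftrightarrow> k \<le> k' \<and> E \<subseteq> E'"
  using merge_forest.wf_digraph_forest_graph[OF E] merge_forest.wf_digraph_forest_graph[OF E']
  by (simp add: PCT_def merge_forest.last_forest_filtration E E' subgraph_def compatible_def)
    (simp add: forest_graph_def nodes_subset_iff)

lemma partial_order_PCT: "partial_order (PCT n)"
proof -
  let ?le = "\<lambda>F F'. subgraph (last F) (last F')"
  have iff: "?le (forest_filtration n k E) (forest_filtration n k' E') \<longleftrightarrow> k \<le> k' \<and> E \<subseteq> E'"
    if "merge_forest n k E" "merge_forest n k' E'" for k k' E E'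
    using le_PCT_forest_filtration[OF that] by (simp add: PCT_def)
  have carrier: "{partial_merge_tree n T k |T k. merge_tree n T \<and> k \<le> n} = carrier (PCT n)"
    by (simp add: PCT_def)
  show ?thesis
    unfolding PCT_def
  proof (rule partial_order_eqI, unfold carrier PCT_iff_forest_filtration)
    show "?le F F" if "\<exists>k\<le>n. \<exists>E. merge_forest n k E \<and> F = forest_filtration n k E" for F
      using that iff by auto
  next
    fix F F'
    assume "\<exists>k\<le>n. \<exists>E. merge_forest n k E \<and> F = forest_filtration n k E"
      and "\<exists>k\<le>n. \<exists>E. merge_forest n k E \<and> F' = forest_filtration n k E"
      and le: "?le F F'" "?le F' F"
    then obtain k E k' E' where "merge_forest n k E" "F = forest_filtration n k E"
      "merge_forest n k' E'" "F' = forest_filtration n k' E'" by blast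
    then show "F = F'" using le iff by auto
  next
    fix F F' F''
    assume "\<exists>k\<le>n. \<exists>E. merge_forest n k E \<and> F = forest_filtration n k E"
      and "\<exists>k\<le>n. \<exists>E. merge_forest n k E \<and> F' = forest_filtration n k E"
      and "\<exists>k\<le>n. \<exists>E. merge_forest n k E \<and> F'' = forest_filtration n k E"
      and le: "?le F F'" "?le F' F''"
    then obtain k E k' E' k'' E'' where "merge_forest n k E" "F = forest_filtration n k E"
      "merge_forest n k' E'" "F' = forest_filtration n k' E'"
      "merge_forest n k'' E''" "F'' = forest_filtration n k'' E''" by blast
    then show "?le F F''" using le iff by auto
  qed
qed

definition levels :: "nat \<Rightarrow> mgraph list \<Rightarrow> nat \<Rightarrow> nat set set" where
  "levels n F = level n (arcs (last F))"

lemma levels_forest_filtration: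
  "merge_forest n k E \<Longrightarrow> levels n (forest_filtration n k E) = level n E"
  by (simp add: levels_def merge_forest.last_forest_filtration)

lemma poset_iso_levels:
  "poset_iso (PCT n) (path_poset (partition_lattice n)) (\<lambda>F. levels n F ` {..length F - 1})"
proof (rule graded_poset.poset_iso_path_posetI[OF graded_poset_partition_lattice partial_order_PCT])
  fix F assume "F \<in> carrier (PCT n)"
  then obtain k E where "merge_forest n k E" "F = forest_filtration n k E"
    unfolding PCT_iff_forest_filtration by blast
  then show "rank_sequence (partition_lattice n) (partition_rank n) (levels n F) (length F - 1)"
    by (simp add: levels_forest_filtration length_forest_filtration merge_forest.rank_sequence_level)
next
  fix F F' assume "F \<in> carrier (PCT n)" "F' \<in> carrier (PCT n)"
  then obtain k E k' E' where E: "merge_forest n k E" "F = forest_filtration n k E"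
    and E': "merge_forest n k' E'" "F' = forest_filtration n k' E'"
    unfolding PCT_iff_forest_filtration by blast
  show "F \<sqsubseteq>\<^bsub>PCT n\<^esub> F' \<longleftrightarrow>
      length F - 1 \<le> length F' - 1 \<and> (\<forall>j\<le>length F - 1. levels n F j = levels n F' j)"
    using merge_forest_subset_iff_levels[OF E(1) E'(1)]
    by (auto simp: E E' le_PCT_forest_filtration levels_forest_filtration length_forest_filtration)
next
  fix t l assume t: "rank_sequence (partition_lattice n) (partition_rank n) t l"
  then obtain E where E: "merge_forest n l E" "\<forall>j\<le>l. level n E j = t j"
    using ex_merge_forest_levels by blast
  have "l \<le> n"
  proof -
    have "t l \<in> carrier (partition_lattice n)" "partition_rank n (t l) = l"
      using t by (auto simp: rank_sequence_def)
    then show ?thesis using graded_poset.rank_le_height[OF graded_poset_partition_lattice] by metis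
  qed
  then have "forest_filtration n l E \<in> carrier (PCT n)"
    using E(1) PCT_iff_forest_filtration by blast
  then show "\<exists>F\<in>carrier (PCT n). length F - 1 = l \<and> (\<forall>j\<le>l. levels n F j = t j)"
    using E by (intro bexI[of _ "forest_filtration n l E"])
      (simp_all add: levels_forest_filtration length_forest_filtration)
qed

section \<open>Persistence\<close>

context merge_forest
begin

lemma oldest_leaf_forest_graph:
  assumes v: "v \<in> nodes n k"
  shows "oldest_leaf (forest_graph n k E) v = Min (leaves E v)"
proof -
  interpret G: wf_digraph "forest_graph n k E" by (rule wf_digraph_forest_graph)
  have "arcs_ends (forest_graph n k E) = E"
    by (simp add: arcs_ends_conv forest_graph_def)
  then have "v \<rightarrow>\<^sup>*\<^bsub>forest_graph n k E\<^esub> w \<longleftrightarrow> (v, w) \<in> E\<^sup>*" for w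
    using G.reachable_conv'[of v w] v by (simp add: forest_graph_def)
  then show ?thesis by (simp add: oldest_leaf_def leaves_def)
qed

lemma elder_pairs_forest_graph:
  "elder_pairs (forest_graph n k E) =
     {(Min (leaves E d), j) | c d j. (Merge j, c) \<in> E \<and> (Merge j, d) \<in> E \<and>
        Min (leaves E c) < Min (leaves E d)}"
proof -
  have "oldest_leaf (forest_graph n k E) y = Min (leaves E y)" if "(x, y) \<in> E" for x y
    using oldest_leaf_forest_graph arcs_in_nodes that by blast
  then show ?thesis unfolding elder_pairs_def arcs_forest_graph
    by (intro Collect_cong ex_cong1) metis
qed

text \<open>Exactly one pair is created at each merge, and its birth index is what \<open>nonoldest\<close> gains there.\<close>

lemma elder_pairs_eq_bars:
  "\<exists>b. elder_pairs (forest_graph n k E) = bars b k \<and>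
     (\<forall>j<k. nonoldest n (level n E (Suc j)) = insert (b (Suc j)) (nonoldest n (level n E j)))"
proof -
  have "\<exists>i. (\<forall>i'. (i', Suc j) \<in> elder_pairs (forest_graph n k E) \<longleftrightarrow> i' = i) \<and>
      nonoldest n (level n E (Suc j)) = insert i (nonoldest n (level n E j))" if j: "j < k" for j
  proof -
    obtain c d where cd: "E `` {Merge (Suc j)} = {c, d}" "c \<in> roots n E j" "d \<in> roots n E j"
        "Min (leaves E c) < Min (leaves E d)"
      and level: "level n E (Suc j) = merge_blocks (level n E j) (leaves E c) (leaves E d)"
      by (rule level_SucE[OF j])
    have children: "(Merge (Suc j), v) \<in> E \<longleftrightarrow> v = c \<or> v = d" for v
      using cd(1) by auto
    have "(i', Suc j) \<in> elder_pairs (forest_graph n k E) \<longleftrightarrow> i' = Min (leaves E d)" for i'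
      unfolding elder_pairs_forest_graph using cd(4) by (auto simp: children)
    moreover have "nonoldest n (level n E (Suc j)) =
        insert (Min (leaves E d)) (nonoldest n (level n E j))"
      unfolding level
      by (rule nonoldest_merge_blocks)
        (use partition_on_level[of j] j cd in \<open>auto simp: level_def\<close>)
    ultimately show ?thesis by blast
  qed
  then obtain f where
    f: "\<And>j i. j < k \<Longrightarrow> (i, Suc j) \<in> elder_pairs (forest_graph n k E) \<longleftrightarrow> i = f j"
      "\<And>j. j < k \<Longrightarrow> nonoldest n (level n E (Suc j)) = insert (f j) (nonoldest n (level n E j))"
    by metis
  define b where "b j = f (j - 1)" for j
  have "elder_pairs (forest_graph n k E) = bars b k"
  proof (rule Set.set_eqI)
    fix p :: "nat \<times> nat"
    obtain i m where p: "p = (i, m)" by (cases p)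
    have "\<exists>j<k. m = Suc j" if "p \<in> elder_pairs (forest_graph n k E)"
      using that arcD unfolding p elder_pairs_forest_graph by blast
    moreover have "\<exists>j<k. m = Suc j" if "p \<in> bars b k"
    proof -
      have "1 \<le> m" "m \<le> k" using that by (simp_all add: p bars_iff)
      then show ?thesis by (intro exI[of _ "m - 1"]) auto
    qed
    moreover have "p \<in> elder_pairs (forest_graph n k E) \<longleftrightarrow> p \<in> bars b k"
      if "j < k" "m = Suc j" for j
      using f(1)[OF that(1), of i] that by (simp add: p b_def bars_iff)
    ultimately show "p \<in> elder_pairs (forest_graph n k E) \<longleftrightarrow> p \<in> bars b k" by blast
  qed
  then show ?thesis using f(2) by (auto simp: b_def)
qed

text \<open>Persistence lands in barcodes because \<open>nonoldest\<close> preserves ranks: the index that dies at a merge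
  has not died before.\<close>

lemma persistence_forest_filtration:
  defines "B \<equiv> persistence (forest_filtration n k E)"
  shows "B \<in> carrier (PCB n)" "card B = k"
    and "\<And>j. j \<le> k \<Longrightarrow> births_until B j = nonoldest n (level n E j)"
proof -
  obtain b where b: "elder_pairs (forest_graph n k E) = bars b k"
      "\<And>j. j < k \<Longrightarrow> nonoldest n (level n E (Suc j)) = insert (b (Suc j)) (nonoldest n (level n E j))"
    using elder_pairs_eq_bars by blast
  have B: "B = bars b k" by (simp add: B_def persistence_def last_forest_filtration b(1))
  have "rank_sequence (subset_lattice n) card (nonoldest n \<circ> level n E) k"
    by (rule rank_preserving_map.rank_sequence_image[OF rank_preserving_map_nonoldest
          rank_sequence_level])
  note bars = bars_of_rank_sequence[OF this, of b]
  show "B \<in> carrier (PCB n)" using bars(1) b(2) B by simp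
  show "card B = k" using B by (simp add: card_bars)
  show "births_until B j = nonoldest n (level n E j)" if "j \<le> k" for j
    using bars(2) b(2) B that by simp
qed

end

theorem theorem2p3:
  fixes n :: nat
  assumes "n \<ge> 1"
  shows "\<exists>\<Phi> \<Psi>.
    poset_iso (PCT n) (path_poset (partition_lattice n)) \<Phi> \<and>
    poset_iso (PCB n) (path_poset (subset_lattice n)) \<Psi> \<and>
    persistence \<in> carrier (PCT n) \<rightarrow> carrier (PCB n) \<and>
    (\<exists>H. poset_map (partition_lattice n) (subset_lattice n) H \<and>
      (\<exists>H'. is_lift (partition_lattice n) (subset_lattice n) H H' \<and>
         (\<forall>G. is_lift (partition_lattice n) (subset_lattice n) H G \<longrightarrow>
              (\<forall>C\<in>carrier (path_poset (partition_lattice n)). G C = H' C)) \<and>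
         (\<forall>F\<in>carrier (PCT n). \<Psi> (persistence F) = H' (\<Phi> F))))"
proof -
  let ?\<Phi> = "\<lambda>F. levels n F ` {..length F - 1}"
  let ?\<Psi> = "\<lambda>B. births_until B ` {..card B}"
  have pers: "persistence F \<in> carrier (PCB n) \<and> ?\<Psi> (persistence F) = nonoldest n ` ?\<Phi> F"
    if mem: "F \<in> carrier (PCT n)" for F
  proof -
    obtain k E where E: "merge_forest n k E" and F: "F = forest_filtration n k E"
      using mem unfolding PCT_iff_forest_filtration by blast
    interpret merge_forest n k E by (rule E)
    show ?thesis
      using persistence_forest_filtration
      by (simp add: F levels_forest_filtration[OF E] length_forest_filtration image_image)
  qed
  show ?thesis
  proof (intro exI conjI allI impI ballI)
    show "poset_iso (PCT n) (path_poset (partition_lattice n)) ?\<Phi>"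
      by (rule poset_iso_levels)
    show "poset_iso (PCB n) (path_poset (subset_lattice n)) ?\<Psi>"
      by (rule poset_iso_births_until)
    show "persistence \<in> carrier (PCT n) \<rightarrow> carrier (PCB n)" using pers by blast
    show "poset_map (partition_lattice n) (subset_lattice n) (nonoldest n)"
      by (rule poset_map_nonoldest)
    show "is_lift (partition_lattice n) (subset_lattice n) (nonoldest n) ((`) (nonoldest n))"
      by (rule rank_preserving_map.image_is_lift[OF rank_preserving_map_nonoldest])
    show "G C = nonoldest n ` C"
      if "is_lift (partition_lattice n) (subset_lattice n) (nonoldest n) G"
        "C \<in> carrier (path_poset (partition_lattice n))" for G C
      using that by (rule rank_preserving_map.lift_unique[OF rank_preserving_map_nonoldest])
    show "?\<Psi> (persistence F) = nonoldest n ` ?\<Phi> F" if "F \<in> carrier (PCT n)" for F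
      using pers[OF that] by blast
  qed
qed

end
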